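(* Let $n\ge4$ and $\lambda,\beta\in\mathbb{C}$. Set $H_a=E_{aa}-E_{a+1,a+1}$ for $1\le a\le n-1$ and $H_n=E_{nn}-E_{11}$. Then the element $$Z=\sum_{a=1}^{n}\left([K(H_a),Q(H_a)]-\frac{\lambda}{4}\sum_{1\le i\ne j\le n}S([H_a,E_{ij}],[E_{ji},H_a])\right)$$ is central in $\mathfrak{D}_{\lambda,\beta}(\mathfrak{sl}_n)$.
   Context: $E_{ij}$ are the elementary $n\times n$ matrices, $S(a,b)=ab+ba$. $\{\epsilon_1,\dots,\epsilon_n\}$ is the standard orthonormal basis of $\mathbb{C}^n$ with inner product $(\cdot,\cdot)$, and $\epsilon_{ij}=\epsilon_i-\epsilon_j$. $\mathfrak{D}_{\lambda,\beta}(\mathfrak{sl}_n)$ is the $\mathbb{C}$-algebra generated by $X,K(X),Q(X),P(X)$ for $X\in\mathfrak{sl}_n$ subject to: $X\mapsto X$, $X\otimes v\mapsto K(X)$ (resp. $X\mapsto X$, $X\otimes u\mapsto Q(X)$) extends to an algebra homomorphism $\mathfrak{U}(\mathfrak{sl}_n[v])\to\mathfrak{D}_{\lambda,\beta}(\mathfrak{sl}_n)$ (resp. $\mathfrak{U}(\mathfrak{sl}_n[u])\to\mathfrak{D}_{\lambda,\beta}(\mathfrak{sl}_n)$), where $\mathfrak{U}$ denotes the enveloping algebra and $\mathfrak{sl}_n[u]=\mathfrak{sl}_n\otimes\mathbb{C}[u]$; $P(X)$ is linear in $X$ and $[P(X),X']=P([X,X'])$ for all $X,X'\in\mathfrak{sl}_n$;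 and for $a\ne b$, $c\ne d$, $(a,b)\ne(d,c)$, $$[K(E_{ab}),Q(E_{cd})]=P([E_{ab},E_{cd}])+\left(\beta-\tfrac{\lambda}{2}\right)(\delta_{bc}E_{ad}+\delta_{ad}E_{cb})-\tfrac{\lambda}{4}(\epsilon_{ab},\epsilon_{cd})S(E_{ab},E_{cd})+\tfrac{\lambda}{4}\sum_{1\le i\ne j\le n}S([E_{ab},E_{ij}],[E_{ji},E_{cd}]).$$ *)

theory Defs
  imports
    "HOL-Library.Poly_Mapping"
    "HOL-Computational_Algebra.Polynomial"
    "HOL-Algebra.QuotRing"
    "Jordan_Normal_Form.Matrix"
begin

section \<open>Free associative algebras over the complex numbers\<close>

datatype 'g fword = FWord (letters: "'g list")

instantiation fword :: (type) monoid_add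
begin
definition zero_fword :: "'g fword" where "zero_fword = FWord []"
definition plus_fword :: "'g fword \<Rightarrow> 'g fword \<Rightarrow> 'g fword"
  where "plus_fword v w = FWord (letters v @ letters w)"
instance by standard (auto simp: zero_fword_def plus_fword_def)
end

lemma letters_zero [simp]: "letters 0 = []"
  by (simp add: zero_fword_def)

lemma letters_plus [simp]: "letters (v + w) = letters v @ letters w"
  by (simp add: plus_fword_def)

text \<open>The monoid of words is written additively because the product that \<^theory>\<open>HOL-Library.Poly_Mapping\<close>
  puts on finitely supported functions is the convolution along an additive monoid.\<close>

type_synonym 'g ncpoly = "'g fword \<Rightarrow>\<^sub>0 complex"

definition gen :: "'g \<Rightarrow> 'g ncpoly"
  where "gen g = Poly_Mapping.single (FWord [g]) 1"

definition scal :: "complex \<Rightarrow> 'g ncpoly"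
  where "scal c = Poly_Mapping.single 0 c"

definition free_algebra :: "'g set \<Rightarrow> 'g ncpoly ring"
  where "free_algebra G =
    \<lparr>carrier = {f. \<forall>w\<in>Poly_Mapping.keys f. set (letters w) \<subseteq> G},
     mult = (*), one = 1, zero = 0, add = (+)\<rparr>"

lemma ring_free_algebra: "ring (free_algebra G)"
proof (rule ringI)
  show "abelian_group (free_algebra G)"
  proof (rule abelian_groupI)
    fix x assume "x \<in> carrier (free_algebra G)"
    then show "\<exists>y\<in>carrier (free_algebra G). y \<oplus>\<^bsub>free_algebra G\<^esub> x = \<zero>\<^bsub>free_algebra G\<^esub>"
      by (intro bexI[of _ "- x"]) (auto simp: free_algebra_def)
  qed (use keys_add in \<open>fastforce simp: free_algebra_def algebra_simps\<close>)+
  show "monoid (free_algebra G)"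
  proof (rule monoidI)
    fix x y assume "x \<in> carrier (free_algebra G)" "y \<in> carrier (free_algebra G)"
    then show "x \<otimes>\<^bsub>free_algebra G\<^esub> y \<in> carrier (free_algebra G)"
      using keys_mult[of x y] by (fastforce simp: free_algebra_def)
  qed (auto simp: free_algebra_def algebra_simps)
qed (auto simp: free_algebra_def algebra_simps)

definition commutator :: "'a::ring \<Rightarrow> 'a \<Rightarrow> 'a"
  where "commutator x y = x * y - y * x"

definition anticommutator :: "'a::ring \<Rightarrow> 'a \<Rightarrow> 'a"
  where "anticommutator x y = x * y + y * x"

definition ring_center :: "('a, 'b) ring_scheme \<Rightarrow> 'a set"
  where "ring_center R = {z \<in> carrier R. \<forall>x\<in>carrier R. z \<otimes>\<^bsub>R\<^esub> x = x \<otimes>\<^bsub>R\<^esub> z}"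


section \<open>The Lie algebras $sl_n$ and $sl_n[v]$\<close>

text \<open>Matrix rows and columns, and all other indices, run through \<open>0, \<dots>, n - 1\<close> instead of
  \<open>1, \<dots>, n\<close>.\<close>

definition sl :: "nat \<Rightarrow> 'a::comm_ring_1 mat set"
  where "sl n = {X \<in> carrier_mat n n. (\<Sum>i<n. X $$ (i, i)) = 0}"

definition lie :: "'a::comm_ring_1 mat \<Rightarrow> 'a mat \<Rightarrow> 'a mat"
  where "lie X Y = X * Y - Y * X"

definition E :: "nat \<Rightarrow> nat \<Rightarrow> nat \<Rightarrow> complex mat"
  where "E n a b = mat n n (\<lambda>(i, j). if i = a \<and> j = b then 1 else 0)"

text \<open>For \<open>a = n - 1\<close> this is \<open>E\<^sub>n\<^sub>n - E\<^sub>1\<^sub>1\<close> in one-based indexing.\<close>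

definition H :: "nat \<Rightarrow> nat \<Rightarrow> complex mat"
  where "H n a = E n a a - E n ((a + 1) mod n) ((a + 1) mod n)"

definition eps :: "nat \<Rightarrow> nat \<Rightarrow> nat \<Rightarrow> complex vec"
  where "eps n a b = unit_vec n a - unit_vec n b"

definition offdiag :: "nat \<Rightarrow> (nat \<times> nat) set"
  where "offdiag n = {(i, j). i < n \<and> j < n \<and> i \<noteq> j}"

text \<open>The current algebra \<open>sl\<^sub>n \<otimes> \<complex>[v]\<close> is taken to be \<open>sl n :: complex poly mat set\<close>, the traceless
  matrices over the polynomial ring, with \<open>X \<otimes> p\<close> the matrix with entries \<open>X\<^sub>i\<^sub>j p\<close>.\<close>

definition tens :: "complex mat \<Rightarrow> complex poly \<Rightarrow> complex poly mat" (infixl \<open>\<otimes>\<^sub>c\<close> 70)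
  where "X \<otimes>\<^sub>c p = map_mat (\<lambda>c. Polynomial.smult c p) X"

definition env_relators :: "nat \<Rightarrow> complex poly mat ncpoly set"
  where "env_relators n =
      {gen (x + y) - gen x - gen y | x y. x \<in> sl n \<and> y \<in> sl n}
    \<union> {gen ([:c:] \<cdot>\<^sub>m x) - scal c * gen x | c x. x \<in> sl n}
    \<union> {gen (lie x y) - commutator (gen x) (gen y) | x y. x \<in> sl n \<and> y \<in> sl n}"

definition env_ideal :: "nat \<Rightarrow> complex poly mat ncpoly set"
  where "env_ideal n = Idl\<^bsub>free_algebra (sl n)\<^esub> (env_relators n)"

definition env :: "nat \<Rightarrow> complex poly mat ncpoly set ring"
  where "env n = free_algebra (sl n) Quot env_ideal n"

definition env_class :: "nat \<Rightarrow> complex poly mat ncpoly \<Rightarrow> complex poly mat ncpoly set"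
  where "env_class n f = env_ideal n +>\<^bsub>free_algebra (sl n)\<^esub> f"


section \<open>The deformed double current algebra\<close>

datatype dca_gen = GX "complex mat" | GK "complex mat" | GQ "complex mat" | GP "complex mat"

abbreviation X' :: "complex mat \<Rightarrow> dca_gen ncpoly" where "X' A \<equiv> gen (GX A)"
abbreviation K' :: "complex mat \<Rightarrow> dca_gen ncpoly" where "K' A \<equiv> gen (GK A)"
abbreviation Q' :: "complex mat \<Rightarrow> dca_gen ncpoly" where "Q' A \<equiv> gen (GQ A)"
abbreviation P' :: "complex mat \<Rightarrow> dca_gen ncpoly" where "P' A \<equiv> gen (GP A)"

definition dca_free :: "nat \<Rightarrow> dca_gen ncpoly ring"
  where "dca_free n = free_algebra (GX ` sl n \<union> GK ` sl n \<union> GQ ` sl n \<union> GP ` sl n)"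

definition P_relators :: "nat \<Rightarrow> dca_gen ncpoly set"
  where "P_relators n =
      {P' (A + B) - P' A - P' B | A B. A \<in> sl n \<and> B \<in> sl n}
    \<union> {P' (c \<cdot>\<^sub>m A) - scal c * P' A | c A. A \<in> sl n}
    \<union> {commutator (P' A) (X' B) - P' (lie A B) | A B. A \<in> sl n \<and> B \<in> sl n}"

text \<open>In \<open>KQ_rhs\<close> a term such as \<open>E n a d\<close> with \<open>a = d\<close> is not in \<open>sl n\<close>, but then its coefficient
  \<open>\<delta>\<^sub>b\<^sub>c\<close> vanishes because of \<open>(a, b) \<noteq> (d, c)\<close>.\<close>

definition KQ_rhs ::
  "nat \<Rightarrow> complex \<Rightarrow> complex \<Rightarrow> nat \<Rightarrow> nat \<Rightarrow> nat \<Rightarrow> nat \<Rightarrow> dca_gen ncpoly"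
  where "KQ_rhs n lam \<beta> a b c d =
      P' (lie (E n a b) (E n c d))
    + scal (\<beta> - lam / 2) *
        (scal (of_bool (b = c)) * X' (E n a d) + scal (of_bool (a = d)) * X' (E n c b))
    - scal (lam / 4 * (eps n a b \<bullet>c eps n c d)) * anticommutator (X' (E n a b)) (X' (E n c d))
    + scal (lam / 4) *
        (\<Sum>(i, j)\<in>offdiag n.
           anticommutator (X' (lie (E n a b) (E n i j))) (X' (lie (E n j i) (E n c d))))"

definition KQ_relators :: "nat \<Rightarrow> complex \<Rightarrow> complex \<Rightarrow> dca_gen ncpoly set"
  where "KQ_relators n lam \<beta> =
    {commutator (K' (E n a b)) (Q' (E n c d)) - KQ_rhs n lam \<beta> a b c d | a b c d.
       (a, b) \<in> offdiag n \<and> (c, d) \<in> offdiag n \<and> (a, b) \<noteq> (d, c)}"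

text \<open>\<open>extends_to_env n J I\<close>: in the quotient of \<open>dca_free n\<close> by \<open>I\<close>, the assignment
  \<open>A \<otimes> 1 \<mapsto> A\<close>, \<open>A \<otimes> v \<mapsto> J A\<close> extends to a homomorphism of unital complex algebras from the
  enveloping algebra of \<open>sl\<^sub>n[v]\<close>. Complex linearity is expressed through the scalars, since
  the ring records carry no scalar multiplication.\<close>

definition extends_to_env ::
  "nat \<Rightarrow> (complex mat \<Rightarrow> dca_gen ncpoly) \<Rightarrow> dca_gen ncpoly set \<Rightarrow> bool"
  where "extends_to_env n J I \<longleftrightarrow>
    (\<exists>\<phi>\<in>Ring.ring_hom (env n) (dca_free n Quot I).
       (\<forall>c. \<phi> (env_class n (scal c)) = I +>\<^bsub>dca_free n\<^esub> scal c) \<and>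
       (\<forall>A\<in>sl n. \<phi> (env_class n (gen (A \<otimes>\<^sub>c 1))) = I +>\<^bsub>dca_free n\<^esub> X' A) \<and>
       (\<forall>A\<in>sl n. \<phi> (env_class n (gen (A \<otimes>\<^sub>c [:0, 1:]))) = I +>\<^bsub>dca_free n\<^esub> J A))"

text \<open>The defining ideal is the least two-sided ideal modulo which all the defining conditions hold.
  Intersecting is legitimate: the enveloping algebra of \<open>sl\<^sub>n[v]\<close> is generated by the elements
  \<open>A \<otimes> 1\<close> and \<open>A \<otimes> v\<close>, so \<open>extends_to_env\<close> says that \<open>I\<close> contains every noncommutative
  polynomial in the \<open>X' A\<close> and \<open>J A\<close> whose counterpart vanishes in the enveloping algebra, a
  condition that is stable under intersections.\<close>

definition dca_ideal :: "nat \<Rightarrow> complex \<Rightarrow> complex \<Rightarrow> dca_gen ncpoly set"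
  where "dca_ideal n lam \<beta> =
    \<Inter> {I. ideal I (dca_free n) \<and> P_relators n \<subseteq> I \<and> KQ_relators n lam \<beta> \<subseteq> I \<and>
           extends_to_env n K' I \<and> extends_to_env n Q' I}"

definition dca :: "nat \<Rightarrow> complex \<Rightarrow> complex \<Rightarrow> dca_gen ncpoly set ring"
  where "dca n lam \<beta> = dca_free n Quot dca_ideal n lam \<beta>"

definition dca_class :: "nat \<Rightarrow> complex \<Rightarrow> complex \<Rightarrow> dca_gen ncpoly \<Rightarrow> dca_gen ncpoly set"
  where "dca_class n lam \<beta> f = dca_ideal n lam \<beta> +>\<^bsub>dca_free n\<^esub> f"

end

theory Submission
  imports Defs
begin

text \<open>Let \<open>x\<^sub>a\<^sub>b\<close>, \<open>k\<^sub>a\<^sub>b\<close>, \<open>q\<^sub>a\<^sub>b\<close>, \<open>p\<^sub>a\<^sub>b\<close> be the images in the algebra of \<open>X\<close>, \<open>K\<close>, \<open>Q\<close>, \<open>P\<close> at the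
  traceless part of \<open>E\<^sub>a\<^sub>b\<close>, let \<open>S\<close> be the anticommutator, and put \<open>\<mu> = \<lambda>/4\<close>, \<open>\<nu> = \<beta> - \<lambda>/2\<close>. The term with
  \<open>(\<epsilon>\<^sub>a\<^sub>b, \<epsilon>\<^sub>c\<^sub>d)\<close> in the defining relation is exactly what the sum over \<open>i \<noteq> j\<close> lacks of the sum over all
  \<open>i, j\<close>. With \<open>w\<^sub>a\<^sub>d = \<Sum>\<^sub>j S(x\<^sub>a\<^sub>j, x\<^sub>j\<^sub>d)\<close> that full sum evaluates in closed form, and the relation becomes
  \<open>[k\<^sub>a\<^sub>b, q\<^sub>c\<^sub>d] = \<delta>\<^sub>b\<^sub>c r\<^sub>a\<^sub>d + \<delta>\<^sub>a\<^sub>d s\<^sub>c\<^sub>b - 2\<mu> S(x\<^sub>a\<^sub>d, x\<^sub>c\<^sub>b)\<close> with \<open>r = p + \<nu>x + \<mu>w\<close> and \<open>s = - p + \<nu>x + \<mu>w\<close>.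

  The right-hand side is defined and \<open>gl\<^sub>n\<close>-covariant for all indices. Hence the difference of the two sides,
  \<open>defect\<close> below, is a covariant tensor that vanishes at all pairs of root vectors that are not
  opposite to each other. Covariance forces such a tensor, on traceless arguments \<open>A\<close>, \<open>B\<close>, to be
  \<open>tr(AB) z\<close> with a single element \<open>z\<close>. The element \<open>z\<close> commutes with \<open>x\<^sub>c\<^sub>d\<close> because, as \<open>n \<ge> 4\<close>, it can be
  written as the defect at \<open>E\<^sub>a\<^sub>b\<close>, \<open>E\<^sub>b\<^sub>a\<close> with \<open>a\<close>, \<open>b\<close> different from \<open>c\<close>, \<open>d\<close>. At \<open>A = B = H\<^sub>a\<close> the trace form is
  \<open>2\<close>, and the terms with \<open>\<nu>\<close> cancel in the sum over \<open>a\<close> because \<open>\<Sum>\<^sub>a H\<^sub>a\<^sup>2\<close> is a scalar matrix. So \<open>Z = 2nz\<close>.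

  It remains to bracket \<open>z\<close> with \<open>k\<^sub>c\<^sub>d\<close>. Again with \<open>a\<close>, \<open>b\<close> different from \<open>c\<close>, \<open>d\<close>, the Jacobi identity
  evaluates the bracket of \<open>[k\<^sub>a\<^sub>b, q\<^sub>b\<^sub>a]\<close>, and only \<open>[r\<^sub>a\<^sub>b, k\<^sub>c\<^sub>d]\<close> is missing, that is, a bracket of a \<open>P\<close> with
  a \<open>K\<close>, on which there is no defining relation. Writing \<open>r\<^sub>a\<^sub>b\<close> as a bracket of a \<open>K\<close> and a \<open>Q\<close> in two ways gives two
  linear equations for \<open>[r\<^sub>a\<^sub>b, k\<^sub>c\<^sub>d]\<close> and \<open>[r\<^sub>c\<^sub>b, k\<^sub>a\<^sub>d]\<close>, whose solution is \<open>r_k_bracket\<close>; with it everything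
  cancels in \<open>z_k_offdiag\<close>. Exchanging \<open>K\<close> and \<open>Q\<close> and the signs of \<open>\<mu>\<close> and \<open>\<nu>\<close> turns the relations into themselves
  and \<open>z\<close> into \<open>- z\<close>, which settles the \<open>Q\<close>; and the \<open>P\<close> are generated by the \<open>X\<close>, \<open>K\<close>, \<open>Q\<close>.

  These computations take place in the quotient by an arbitrary ideal satisfying the defining conditions. In order
  to calculate with genuine equations in a type of class \<^class>\<open>ring\<close>, all quotients of the free algebra are
  collected into one ring, the product of all of them, and each single quotient embeds as a factor.\<close>

section \<open>Brackets and covariant families\<close>

lemma commutator_linear:
  "commutator (x + y) z = commutator x z + commutator y z"
  "commutator x (y + z) = commutator x y + commutator x z"
  "commutator (x - y) z = commutator x z - commutator y z"
  "commutator x (y - z) = commutator x y - commutator x z"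
  "commutator (- x) z = - commutator x z"
  "commutator x (- z) = - commutator x z"
  "commutator 0 z = 0"
  "commutator z 0 = 0"
  by (simp_all add: commutator_def algebra_simps)

lemma anticommutator_linear:
  "anticommutator (x + y) z = anticommutator x z + anticommutator y z"
  "anticommutator x (y + z) = anticommutator x y + anticommutator x z"
  "anticommutator (x - y) z = anticommutator x z - anticommutator y z"
  "anticommutator x (y - z) = anticommutator x y - anticommutator x z"
  "anticommutator (- x) z = - anticommutator x z"
  "anticommutator x (- z) = - anticommutator x z"
  "anticommutator 0 z = 0"
  "anticommutator z 0 = 0"
  by (simp_all add: anticommutator_def algebra_simps)

lemma anticommutator_commute: "anticommutator x y = anticommutator y x"
  by (simp add: anticommutator_def add.commute)

lemma commutator_swap: "commutator x y = - commutator y x"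
  by (simp add: commutator_def)

text \<open>The brackets with a fixed element are derivations for both products. Rewriting with these rules and with
  bilinearity reduces every bracket below to brackets of generators.\<close>
lemma commutator_derivation:
  "commutator (anticommutator x y) z
     = anticommutator (commutator x z) y + anticommutator x (commutator y z)"
  "commutator (commutator x y) z
     = commutator (commutator x z) y + commutator x (commutator y z)"
  "commutator z (anticommutator x y)
     = anticommutator (commutator z x) y + anticommutator x (commutator z y)"
  by (simp_all add: commutator_def anticommutator_def algebra_simps)

lemma commutator_sum_left: "commutator (\<Sum>i\<in>I. f i) z = (\<Sum>i\<in>I. commutator (f i) z)"
  by (simp add: commutator_def sum_distrib_left sum_distrib_right sum_subtractf)

lemma commutator_sum_right: "commutator z (\<Sum>i\<in>I. f i) = (\<Sum>i\<in>I. commutator z (f i))"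
  by (simp add: commutator_def sum_distrib_left sum_distrib_right sum_subtractf)

lemma sum_cyclic_shift:
  fixes f :: "nat \<Rightarrow> 'b::comm_monoid_add"
  assumes "n > 0"
  shows "(\<Sum>a<n. f ((a + 1) mod n)) = (\<Sum>a<n. f a)"
proof -
  obtain m where "n = Suc m" using assms gr0_conv_Suc by blast
  moreover have "(\<Sum>a<m. f ((a + 1) mod Suc m)) = (\<Sum>a<m. f (Suc a))"
    by (rule sum.cong) auto
  moreover have "(\<Sum>a<Suc m. f a) = (\<Sum>a<m. f (Suc a)) + f 0"
    by (simp only: sum.lessThan_Suc_shift add.commute)
  ultimately show ?thesis by simp
qed

text \<open>The family \<open>v\<close> transforms under the brackets with \<open>x\<close> like the matrix units under the adjoint action of \<open>gl\<^sub>n\<close>.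
  Using all index pairs, diagonal ones included, avoids the case distinctions that a basis of \<open>sl\<^sub>n\<close> would bring.\<close>
definition gl_covariant :: "nat \<Rightarrow> (nat \<Rightarrow> nat \<Rightarrow> 'a::ring) \<Rightarrow> (nat \<Rightarrow> nat \<Rightarrow> 'a) \<Rightarrow> bool"
  where "gl_covariant n x v \<longleftrightarrow> (\<forall>a<n. \<forall>b<n. \<forall>c<n. \<forall>d<n.
    commutator (v a b) (x c d) = (if b = c then v a d else 0) - (if a = d then v c b else 0))"

lemma gl_covariantD:
  assumes "gl_covariant n x v" "a < n" "b < n" "c < n" "d < n"
  shows "commutator (v a b) (x c d) = (if b = c then v a d else 0) - (if a = d then v c b else 0)"
  using assms by (simp add: gl_covariant_def)

text \<open>Twice the square of the matrix \<open>(x\<^sub>a\<^sub>b)\<close>, with the products of entries symmetrised.\<close>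
definition quad :: "nat \<Rightarrow> (nat \<Rightarrow> nat \<Rightarrow> 'a::ring) \<Rightarrow> nat \<Rightarrow> nat \<Rightarrow> 'a"
  where "quad n x a d = (\<Sum>j<n. anticommutator (x a j) (x j d))"

text \<open>The derivation rule moves the bracket to either factor; the two contributions in which the summation index is
  replaced cancel each other.\<close>
lemma gl_covariant_quad:
  assumes "gl_covariant n x x"
  shows "gl_covariant n x (quad n x)"
  unfolding gl_covariant_def
proof (intro allI impI)
  fix a b c d assume i: "a < n" "b < n" "c < n" "d < n"
  have "commutator (quad n x a b) (x c d) =
     (\<Sum>j<n. (if j = c then anticommutator (x a d) (x c b) else 0) - (if a = d then anticommutator (x c j) (x j b) else 0)
        + ((if b = c then anticommutator (x a j) (x j d) else 0) - (if j = d then anticommutator (x a d) (x c b) else 0)))"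
    unfolding quad_def commutator_sum_left
    by (rule sum.cong) (auto simp: i commutator_derivation gl_covariantD[OF assms] anticommutator_linear)
  also have "\<dots> = (if b = c then quad n x a d else 0) - (if a = d then quad n x c b else 0)"
    by (simp add: sum.distrib sum_subtractf i quad_def)
  finally show "commutator (quad n x a b) (x c d) = \<dots>" .
qed

text \<open>Each of the two brackets has two terms. The products of like-placed terms are matrix products and give the two
  \<^const>\<open>quad\<close> terms; in the mixed products both summation indices are determined.\<close>
lemma sum_anticommutator_brackets:
  assumes "gl_covariant n x x" "a < n" "b < n" "c < n" "d < n"
  shows "(\<Sum>i<n. \<Sum>j<n. anticommutator (commutator (x a b) (x i j)) (commutator (x j i) (x c d)))
    = (if b = c then quad n x a d else 0) + (if a = d then quad n x c b else 0)
      - anticommutator (x a d) (x c b) - anticommutator (x a d) (x c b)"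
proof -
  have "anticommutator (commutator (x a b) (x i j)) (commutator (x j i) (x c d))
    = (if i = b then if b = c then anticommutator (x a j) (x j d) else 0 else 0)
      + (if j = a then if a = d then anticommutator (x c i) (x i b) else 0 else 0)
      - (if i = b then if j = d then anticommutator (x a d) (x c b) else 0 else 0)
      - (if j = a then if i = c then anticommutator (x a d) (x c b) else 0 else 0)"
    if "i < n" "j < n" for i j
    using that assms
    by (auto simp: gl_covariantD[OF assms(1)] anticommutator_linear anticommutator_commute)
  moreover have pull: "(\<Sum>j<n. if B then f j else 0) = (if B then sum f {..<n} else 0)" for B and f :: "nat \<Rightarrow> 'a"
    by simp
  ultimately show ?thesis
    using assms(2-)
    by (simp add: sum.distrib sum_subtractf quad_def pull)
qed

text \<open>The diagonal part of the full sum is minus the scalar product of \<open>\<epsilon>\<^sub>a\<^sub>b\<close> and \<open>\<epsilon>\<^sub>c\<^sub>d\<close> times \<open>S\<close>. It cancels the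
  \<open>\<epsilon>\<close>-term of the defining relation, which is why that term is there.\<close>
lemma sum_offdiag_brackets:
  assumes x: "gl_covariant n x x" and i: "a < n" "b < n" "c < n" "d < n"
  defines "S \<equiv> anticommutator (x a b) (x c d)"
  shows "(\<Sum>(i, j)\<in>offdiag n. anticommutator (commutator (x a b) (x i j)) (commutator (x j i) (x c d)))
    = (if b = c then quad n x a d else 0) + (if a = d then quad n x c b else 0)
      - anticommutator (x a d) (x c b) - anticommutator (x a d) (x c b)
      + ((if a = c then S else 0) - (if a = d then S else 0) - (if b = c then S else 0) + (if b = d then S else 0))"
proof -
  let ?f = "\<lambda>i j. anticommutator (commutator (x a b) (x i j)) (commutator (x j i) (x c d))"
  have "(\<Sum>i<n. \<Sum>j<n. ?f i j) = (\<Sum>(i, j)\<in>{..<n} \<times> {..<n}. ?f i j)"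
    by (simp add: sum.cartesian_product)
  also have "{..<n} \<times> {..<n} = offdiag n \<union> (\<lambda>i. (i, i)) ` {..<n}"
    by (auto simp: offdiag_def)
  also have "(\<Sum>(i, j)\<in>offdiag n \<union> (\<lambda>i. (i, i)) ` {..<n}. ?f i j)
      = (\<Sum>(i, j)\<in>offdiag n. ?f i j) + (\<Sum>(i, j)\<in>(\<lambda>i. (i, i)) ` {..<n}. ?f i j)"
    by (rule sum.union_disjoint)
      (auto simp: offdiag_def intro: finite_subset[of _ "{..<n} \<times> {..<n}"])
  also have "(\<Sum>(i, j)\<in>(\<lambda>i. (i, i)) ` {..<n}. ?f i j) = (\<Sum>i<n. ?f i i)"
    by (subst sum.reindex) (auto simp: inj_on_def)
  also have "\<dots> = (\<Sum>i<n. (if i = b then (if b = c then S else 0) - (if b = d then S else 0) else 0)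
       - (if i = a then (if a = c then S else 0) - (if a = d then S else 0) else 0))"
    using i by (intro sum.cong) (auto simp: gl_covariantD[OF x] anticommutator_linear S_def)
  also have "\<dots> = (if b = c then S else 0) - (if b = d then S else 0)
       - ((if a = c then S else 0) - (if a = d then S else 0))"
    using i by (simp add: sum_subtractf)
  finally show ?thesis
    unfolding sum_anticommutator_brackets[OF x i] by (simp add: algebra_simps)
qed

section \<open>The central element in coordinates\<close>

text \<open>The relations of the algebra in coordinates, with \<open>\<mu> = \<lambda>/4\<close> and \<open>\<nu> = \<beta> - \<lambda>/2\<close>. These are elements of the ring
  and not complex numbers, so that no scalar multiplication is involved. In the last relation the
  sum over all \<open>i\<close>, \<open>j\<close> is already evaluated.\<close>
locale kq_algebra =
  fixes n :: nat and x k q p :: "nat \<Rightarrow> nat \<Rightarrow> 'a::ring" and mu nu :: 'a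
  assumes n_ge_4: "4 \<le> n"
    and mu_central: "mu * y = y * mu"
    and nu_central: "nu * y = y * nu"
    and no_2_torsion: "y + y = 0 \<Longrightarrow> y = (0 :: 'a)"
    and x_covariant: "gl_covariant n x x"
    and k_covariant: "gl_covariant n x k"
    and q_covariant: "gl_covariant n x q"
    and p_covariant: "gl_covariant n x p"
    and trace_x: "(\<Sum>a<n. x a a) = 0"
    and k_commute: "\<lbrakk>a < n; b < n; c < n; d < n; b \<noteq> c; a \<noteq> d\<rbrakk> \<Longrightarrow> commutator (k a b) (k c d) = 0"
    and q_commute: "\<lbrakk>a < n; b < n; c < n; d < n; b \<noteq> c; a \<noteq> d\<rbrakk> \<Longrightarrow> commutator (q a b) (q c d) = 0"
    and kq_relation: "\<lbrakk>a < n; b < n; c < n; d < n; a \<noteq> b; c \<noteq> d; \<not> (a = d \<and> b = c)\<rbrakk> \<Longrightarrow>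
      commutator (k a b) (q c d) =
        (if b = c then p a d + nu * x a d + mu * quad n x a d else 0)
      + (if a = d then - p c b + nu * x c b + mu * quad n x c b else 0)
      - mu * (anticommutator (x a d) (x c b) + anticommutator (x a d) (x c b))"
begin

definition r where "r a d = p a d + nu * x a d + mu * quad n x a d"
definition s where "s a d = - p a d + nu * x a d + mu * quad n x a d"

lemma commutator_mu_left: "commutator (mu * y) z = mu * commutator y z"
  using mu_central[of z] by (simp add: commutator_def algebra_simps flip: mult.assoc)

lemma commutator_nu_left: "commutator (nu * y) z = nu * commutator y z"
  using nu_central[of z] by (simp add: commutator_def algebra_simps flip: mult.assoc)

lemma quad_covariant: "gl_covariant n x (quad n x)"
  by (rule gl_covariant_quad[OF x_covariant])

lemma r_covariant: "gl_covariant n x r"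
  unfolding gl_covariant_def r_def
  by (auto simp: commutator_linear commutator_mu_left commutator_nu_left
      gl_covariantD[OF x_covariant] gl_covariantD[OF p_covariant] gl_covariantD[OF quad_covariant] algebra_simps)

lemma s_covariant: "gl_covariant n x s"
  unfolding gl_covariant_def s_def
  by (auto simp: commutator_linear commutator_mu_left commutator_nu_left
      gl_covariantD[OF x_covariant] gl_covariantD[OF p_covariant] gl_covariantD[OF quad_covariant] algebra_simps)

lemmas brackets = gl_covariantD[OF x_covariant] gl_covariantD[OF k_covariant] gl_covariantD[OF q_covariant] gl_covariantD[OF p_covariant]
  gl_covariantD[OF quad_covariant] gl_covariantD[OF r_covariant] gl_covariantD[OF s_covariant]

lemma x_k_bracket: "\<lbrakk>a < n; b < n; c < n; d < n\<rbrakk> \<Longrightarrow>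
    commutator (x a b) (k c d) = (if b = c then k a d else 0) - (if a = d then k c b else 0)"
  using commutator_swap[of "x a b" "k c d"] by (auto simp: brackets)

text \<open>The deviation of the relation between \<open>k\<close> and \<open>q\<close> from its continuation to all indices. As a function of the two
  index pairs it is a covariant tensor, being composed of covariant pieces.\<close>
definition defect where
  "defect a b c d = commutator (k a b) (q c d) - (if b = c then r a d else 0) - (if a = d then s c b else 0)
    + mu * (anticommutator (x a d) (x c b) + anticommutator (x a d) (x c b))"

lemma defect_zero:
  "\<lbrakk>a < n; b < n; c < n; d < n; a \<noteq> b; c \<noteq> d; \<not> (a = d \<and> b = c)\<rbrakk> \<Longrightarrow> defect a b c d = 0"
  by (simp add: defect_def kq_relation r_def s_def)

lemma defect_covariant:
  assumes "a < n" "b < n" "c < n" "d < n" "e < n" "f < n"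
  shows "commutator (defect a b c d) (x e f) =
    (if b = e then defect a f c d else 0) - (if a = f then defect e b c d else 0)
    + (if d = e then defect a b c f else 0) - (if c = f then defect a b e d else 0)"
  unfolding defect_def using assms
  by (simp add: commutator_linear commutator_mu_left commutator_derivation brackets
      anticommutator_linear algebra_simps)

definition z where "z = defect 0 1 1 0"

text \<open>A bracket of a vanishing component with a suitable \<open>x\<close> shows that two components \<open>defect a b b a\<close> with a common
  index in the same position agree; any two ordered pairs of distinct indices are linked by such exchanges.\<close>
lemma defect_diag:
  assumes "a < n" "b < n" "a \<noteq> b"
  shows "defect a b b a = z"
proof -
  have step1: "defect a b b a = defect c b b c" if "a < n" "b < n" "c < n" "a \<noteq> b" "b \<noteq> c" "a \<noteq> c" for a b c
    using defect_covariant[of a b b c c a] defect_zero[of a b b c] that by (auto simp: commutator_linear)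
  have step2: "defect a b b a = defect a c c a" if "a < n" "b < n" "c < n" "a \<noteq> b" "b \<noteq> c" "a \<noteq> c" for a b c
    using defect_covariant[of a b c a b c] defect_zero[of a b c a] that by (auto simp: commutator_linear)
  have fin: "defect a b b a = z" if "a < n" "b < n" "a \<noteq> b" "b \<noteq> 0" for a b
  proof (cases "b = 1")
    case True
    then show ?thesis using step1[of a b 0] that n_ge_4 unfolding z_def by (cases "a = 0") auto
  next
    case False
    have "defect a b b a = defect 0 b b 0" using step1[of a b 0] that n_ge_4 by (cases "a = 0") auto
    also have "\<dots> = defect 0 1 1 0" using step2[of 0 b 1] that False n_ge_4 by auto
    finally show ?thesis by (simp add: z_def)
  qed
  show ?thesis
  proof (cases "b = 0")
    case False then show ?thesis using fin assms by blast
  next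
    case True
    define c where "c = (if a = 1 then 2 else 1 :: nat)"
    have c: "c < n" "c \<noteq> a" "c \<noteq> 0" using n_ge_4 by (auto simp: c_def)
    have "defect a b b a = defect a c c a" using step2[of a b c] assms c True by auto
    then show ?thesis using fin[of a c] assms c by simp
  qed
qed

lemma two_more_indices:
  assumes "c < n" "d < n"
  obtains a b where "a < n" "b < n" "a \<noteq> b" "a \<noteq> c" "a \<noteq> d" "b \<noteq> c" "b \<noteq> d"
proof -
  have "card {c, d} \<le> 2" by (simp add: card_insert_if)
  moreover have "card ({..<n} - {c, d}) \<ge> card {..<n} - card {c, d}"
    by (rule diff_card_le_card_Diff) simp
  ultimately have *: "card ({..<n} - {c, d}) \<ge> 2" using n_ge_4 by simp
  then obtain T where "T \<subseteq> {..<n} - {c, d}" "card T = 2"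
    using obtain_subset_with_card_n by metis
  then show ?thesis using that by (auto simp: card_2_iff)
qed

lemma z_x:
  assumes "c < n" "d < n"
  shows "commutator z (x c d) = 0"
proof -
  obtain a b where "a < n" "b < n" "a \<noteq> b" "a \<noteq> c" "a \<noteq> d" "b \<noteq> c" "b \<noteq> d"
    by (rule two_more_indices[OF assms(1,2)])
  then show ?thesis
    using defect_covariant[of a b b a c d] assms by (auto simp: defect_diag)
qed

text \<open>The element \<open>v c c - v d d\<close> is the bracket of \<open>v c d\<close> with \<open>x d c\<close>, so that the Jacobi identity applies.\<close>
lemma offdiag_to_cartan:
  assumes vx: "gl_covariant n x v" and y: "\<And>c d. \<lbrakk>c < n; d < n; c \<noteq> d\<rbrakk> \<Longrightarrow> commutator y (v c d) = 0"
    and yx: "\<And>c d. \<lbrakk>c < n; d < n; c \<noteq> d\<rbrakk> \<Longrightarrow> commutator y (x c d) = 0"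
    and "c < n" "d < n"
  shows "commutator y (v c c - v d d) = 0"
proof (cases "c = d")
  case False
  have "commutator (commutator y (v c d)) (x d c) =
    commutator (commutator y (x d c)) (v c d) + commutator y (commutator (v c d) (x d c))"
    by (rule commutator_derivation)
  then show ?thesis
    using False assms(4,5) by (simp add: y yx commutator_linear gl_covariantD[OF vx])
qed (simp add: commutator_linear)

text \<open>The tensor also vanishes at a root vector paired with a diagonal traceless matrix: at \<open>E\<^sub>c\<^sub>c - E\<^sub>d\<^sub>d\<close>
  with \<open>{c, d}\<close> different from \<open>{a, b}\<close> this follows from a bracket of a vanishing component, and a third index \<open>e\<close>
  reduces the remaining case to these.\<close>
lemma defect_cartan_right:
  assumes "a < n" "b < n" "a \<noteq> b"
  shows "defect a b a a - defect a b b b = 0"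
proof -
  have *: "defect a b c c - defect a b d d = 0"
    if "c < n" "d < n" "c \<noteq> d" "\<not> (a = d \<and> b = c)" "\<not> (a = c \<and> b = d)" for c d
  proof -
    have "defect a b c d = 0" "b = d \<Longrightarrow> defect a c c d = 0" "a = c \<Longrightarrow> defect d b c d = 0"
      by (rule defect_zero; use that assms in blast)+
    then show ?thesis
      using defect_covariant[of a b c d d c] that(1-3) assms(1,2)
      by (cases "a = c"; cases "b = d") (simp_all add: commutator_linear(7))
  qed
  obtain e where "e < n" "e \<noteq> a" "e \<noteq> b"
    using two_more_indices[OF assms(1,2)] by blast
  then show ?thesis
    using *[of a e] *[of e b] assms by auto
qed

text \<open>The value of the tensor at the pair \<open>(H, H)\<close> with \<open>H = E\<^sub>a\<^sub>a - E\<^sub>b\<^sub>b\<close>: the trace form there is \<open>2\<close>.\<close>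
lemma defect_cartan:
  assumes "a < n" "b < n" "a \<noteq> b"
  shows "defect a a a a - defect a a b b - defect b b a a + defect b b b b = z + z"
proof -
  have "0 = commutator (defect a b a a - defect a b b b) (x b a)"
    by (simp only: defect_cartan_right[OF assms] commutator_linear)
  also have "\<dots> = (defect a a a a - defect b b a a - z) - (defect a a b b - defect b b b b + z)"
    using assms by (simp add: commutator_linear defect_covariant defect_diag)
  finally show ?thesis by (simp add: algebra_simps)
qed

lemma r_offdiag:
  assumes "a < n" "b < n" "c < n" "a \<noteq> b" "a \<noteq> c" "b \<noteq> c"
  shows "r a b = commutator (k a c) (q c b) + mu * (anticommutator (x a b) (x c c) + anticommutator (x a b) (x c c))"
  using defect_zero[of a c c b] assms by (simp add: defect_def algebra_simps)

lemma k_q_bracket: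
  assumes "a < n" "b < n" "c < n" "d < n" "a \<noteq> b" "c \<noteq> d" "\<not> (a = d \<and> b = c)"
  shows "commutator (k a b) (q c d) = (if b = c then r a d else 0) + (if a = d then s c b else 0)
    - mu * (anticommutator (x a d) (x c b) + anticommutator (x a d) (x c b))"
  using defect_zero[of a b c d] assms by (simp add: defect_def algebra_simps)

lemma q_k_bracket:
  assumes "a < n" "b < n" "c < n" "d < n" "a \<noteq> b" "c \<noteq> d" "\<not> (a = d \<and> b = c)"
  shows "commutator (q c d) (k a b) = mu * (anticommutator (x a d) (x c b) + anticommutator (x a d) (x c b))
    - (if b = c then r a d else 0) - (if a = d then s c b else 0)"
  using k_q_bracket[OF assms] commutator_swap[of "q c d" "k a b"] by (simp add: algebra_simps)

lemma commutator_mu_right: "commutator u (mu * y) = mu * commutator u y"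
  using commutator_mu_left[of y u] by (simp add: commutator_def algebra_simps)

text \<open>With \<open>r a b\<close> expressed through \<open>k a c\<close> and \<open>q c b\<close>, the bracket of \<open>k a c\<close> and \<open>k a d\<close> vanishes, and \<open>q c b\<close> with
  \<open>k a d\<close> leaves only quadratic terms in \<open>x\<close>.\<close>
lemma r_k_same_row:
  assumes "a < n" "b < n" "c < n" "d < n" "distinct [a, b, c, d]"
  shows "commutator (r a b) (k a d) = mu * (anticommutator (x a b) (k a d) + anticommutator (x a b) (k a d))"
proof -
  have "commutator (r a b) (k a d) = commutator (k a c) (commutator (q c b) (k a d))"
    using assms by (simp add: r_offdiag[of a b c] commutator_derivation commutator_linear k_commute commutator_mu_left
      x_k_bracket anticommutator_linear)
  also have "\<dots> = mu * commutator (k a c) (anticommutator (x a b) (x c d) + anticommutator (x a b) (x c d))"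
    using assms by (simp add: q_k_bracket commutator_mu_right)
  also have "commutator (k a c) (anticommutator (x a b) (x c d) + anticommutator (x a b) (x c d))
      = anticommutator (x a b) (k a d) + anticommutator (x a b) (k a d)"
    using assms by (simp add: commutator_linear commutator_derivation brackets anticommutator_linear)
  finally show ?thesis .
qed

text \<open>Expressing \<open>r a b\<close> through \<open>k a d\<close> and \<open>q d b\<close> gives the difference of this bracket and the one with \<open>a\<close> and \<open>c\<close>
  exchanged; applying \<open>x c a\<close> to the preceding lemma gives their sum.\<close>
lemma r_k_bracket:
  assumes "a < n" "b < n" "c < n" "d < n" "distinct [a, b, c, d]"
  shows "commutator (r a b) (k c d) = mu * (anticommutator (x c b) (k a d) + anticommutator (x c b) (k a d))"
proof -
  \<comment> \<open>The bracket of \<open>k a d\<close> and \<open>k c d\<close> vanishes, while \<open>q d b\<close> and \<open>k c d\<close> reproduce an \<open>r\<close>.\<close>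
  have "commutator (r a b) (k c d) = commutator (k a d) (commutator (q d b) (k c d))
      - mu * (anticommutator (x a b) (k c d) + anticommutator (x a b) (k c d))"
    using assms by (simp add: r_offdiag[of a b d] commutator_derivation commutator_linear k_commute commutator_mu_left
      x_k_bracket anticommutator_linear algebra_simps)
  also have "commutator (k a d) (commutator (q d b) (k c d)) = commutator (r c b) (k a d)
      + mu * (anticommutator (x c b) (k a d) + anticommutator (x c b) (k a d))"
    using assms commutator_swap[of "r c b" "k a d"]
    by (simp add: q_k_bracket commutator_mu_right commutator_linear commutator_derivation brackets anticommutator_linear)
  finally have A: "commutator (r a b) (k c d) - commutator (r c b) (k a d) =
      mu * (anticommutator (x c b) (k a d) + anticommutator (x c b) (k a d))
      - mu * (anticommutator (x a b) (k c d) + anticommutator (x a b) (k c d))"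
    by simp
  have "commutator (commutator (r a b) (k a d)) (x c a)
      = commutator (mu * (anticommutator (x a b) (k a d) + anticommutator (x a b) (k a d))) (x c a)"
    using r_k_same_row assms by simp
  then have B: "commutator (r a b) (k c d) + commutator (r c b) (k a d) =
      mu * (anticommutator (x c b) (k a d) + anticommutator (x c b) (k a d))
      + mu * (anticommutator (x a b) (k c d) + anticommutator (x a b) (k c d))"
    using assms by (simp add: commutator_mu_left commutator_linear commutator_derivation brackets anticommutator_linear
      algebra_simps neg_eq_iff_add_eq_0 eq_neg_iff_add_eq_0 minus_equation_iff)
  define D where "D = commutator (r a b) (k c d) - mu * (anticommutator (x c b) (k a d) + anticommutator (x c b) (k a d))"
  have "D + D = (commutator (r a b) (k c d) - commutator (r c b) (k a d))
      + (commutator (r a b) (k c d) + commutator (r c b) (k a d))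
      - mu * (anticommutator (x c b) (k a d) + anticommutator (x c b) (k a d))
      - mu * (anticommutator (x c b) (k a d) + anticommutator (x c b) (k a d))"
    by (simp add: D_def)
  also have "\<dots> = 0"
    unfolding A B by simp
  finally have "D + D = 0" .
  then show ?thesis using no_2_torsion[of D] by (simp add: D_def)
qed

lemma quad_k_bracket:
  assumes "b < n" "c < n" "d < n" "b \<noteq> c" "b \<noteq> d" "c \<noteq> d"
  shows "commutator (quad n x b b) (k c d) = anticommutator (k b d) (x c b) - anticommutator (x b d) (k c b)"
proof -
  have "commutator (quad n x b b) (k c d) =
     (\<Sum>j<n. (if j = c then anticommutator (k b d) (x c b) else 0)
        - (if j = d then anticommutator (x b d) (k c b) else 0))"
    unfolding quad_def commutator_sum_left
    by (rule sum.cong) (use assms in \<open>auto simp: commutator_derivation x_k_bracket anticommutator_linear\<close>)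
  then show ?thesis using assms by (simp add: sum_subtractf)
qed

text \<open>All terms of the bracket are multiples of \<open>\<mu>\<close> by anticommutators of an \<open>x\<close> and a \<open>k\<close>; they cancel in pairs by
  the symmetry of the anticommutator.\<close>
lemma z_k_offdiag:
  assumes "c < n" "d < n" "c \<noteq> d"
  shows "commutator z (k c d) = 0"
proof -
  obtain a b where i: "a < n" "b < n" "a \<noteq> b" "a \<noteq> c" "a \<noteq> d" "b \<noteq> c" "b \<noteq> d"
    by (rule two_more_indices[OF assms(1,2)])
  note i = i assms
  have T1: "commutator (commutator (k a b) (q b a)) (k c d)
     = mu * (anticommutator (x c a) (k a d) + anticommutator (x c a) (k a d)
           - anticommutator (k c b) (x b d) - anticommutator (k c b) (x b d))"
    using i by (simp add: commutator_derivation k_commute commutator_linear anticommutator_linear q_k_bracket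
      commutator_mu_right brackets algebra_simps)
  \<comment> \<open>The element \<open>x b a\<close> commutes with \<open>k c d\<close>, and bracketing with it turns \<open>r a b\<close> into \<open>r a a - r b b\<close>.\<close>
  have "commutator (commutator (r a b) (k c d)) (x b a) =
     commutator (mu * (anticommutator (x c b) (k a d) + anticommutator (x c b) (k a d))) (x b a)"
    using i by (simp add: r_k_bracket)
  then have T2: "commutator (r a a) (k c d) - commutator (r b b) (k c d)
     = mu * (anticommutator (x c a) (k a d) + anticommutator (x c a) (k a d)
           - anticommutator (x c b) (k b d) - anticommutator (x c b) (k b d))"
    using i by (simp add: commutator_mu_left commutator_derivation brackets commutator_linear anticommutator_linear algebra_simps)
  have "s b b = nu * (x b b + x b b) + mu * (quad n x b b + quad n x b b) - r b b"
    by (simp add: s_def r_def algebra_simps)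
  then have "commutator (s b b) (k c d) = commutator
      (nu * (x b b + x b b) + mu * (quad n x b b + quad n x b b) - r b b) (k c d)"
    by (rule arg_cong)
  also have "\<dots> = - commutator (r b b) (k c d)
     + mu * (anticommutator (k b d) (x c b) - anticommutator (x b d) (k c b)
           + anticommutator (k b d) (x c b) - anticommutator (x b d) (k c b))"
    using i by (simp add: commutator_nu_left commutator_mu_left commutator_linear x_k_bracket quad_k_bracket algebra_simps)
  finally have T3: "commutator (s b b) (k c d) = - commutator (r b b) (k c d)
     + mu * (anticommutator (k b d) (x c b) - anticommutator (x b d) (k c b)
           + anticommutator (k b d) (x c b) - anticommutator (x b d) (k c b))" .
  have "z = commutator (k a b) (q b a) - r a a - s b b
     + mu * (anticommutator (x a a) (x b b) + anticommutator (x a a) (x b b))"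
    using defect_diag[of a b] i by (simp add: defect_def)
  then have "commutator z (k c d) = commutator (commutator (k a b) (q b a)) (k c d)
     - (commutator (r a a) (k c d) - commutator (r b b) (k c d))
     - (commutator (s b b) (k c d) + commutator (r b b) (k c d))"
    using i by (simp add: commutator_linear commutator_mu_left commutator_derivation(1) x_k_bracket anticommutator_linear)
  then show ?thesis
    unfolding T1 T2 T3
    by (simp add: anticommutator_commute[of "k _ _"] algebra_simps)
qed

text \<open>Exchanging \<open>k\<close> and \<open>q\<close> reverses the brackets, so that \<open>r\<close> and \<open>s\<close> turn into \<open>- s\<close> and \<open>- r\<close>. That is the effect of
  changing the signs of \<open>\<mu>\<close> and \<open>\<nu>\<close> while keeping \<open>p\<close>.\<close>
lemma dual: "kq_algebra n x q k p (- mu) (- nu)"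
proof (unfold_locales)
  fix a b c d assume "a < n" "b < n" "c < n" "d < n" "a \<noteq> b" "c \<noteq> d" "\<not> (a = d \<and> b = c)"
  then show "commutator (q a b) (k c d) =
        (if b = c then p a d + - nu * x a d + - mu * quad n x a d else 0)
      + (if a = d then - p c b + - nu * x c b + - mu * quad n x c b else 0)
      - (- mu) * (anticommutator (x a d) (x c b) + anticommutator (x a d) (x c b))"
    using q_k_bracket[of c d a b] by (auto simp: r_def s_def anticommutator_commute algebra_simps)
next
  fix y :: 'a
  show "- mu * y = y * - mu" "- nu * y = y * - nu"
    using mu_central[of y] nu_central[of y] by simp_all
qed (fact n_ge_4 x_covariant k_covariant q_covariant p_covariant trace_x | rule no_2_torsion k_commute q_commute; assumption)+

lemma z_q_offdiag:
  assumes "c < n" "d < n" "c \<noteq> d"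
  shows "commutator z (q c d) = 0"
proof -
  interpret dual: kq_algebra n x q k p "- mu" "- nu" by (rule dual)
  have "dual.z = - defect 1 0 0 1"
    unfolding dual.z_def dual.defect_def defect_def dual.r_def dual.s_def r_def s_def
    using commutator_swap[of "q 0 1" "k 1 0"] by (simp add: anticommutator_commute algebra_simps)
  also have "\<dots> = - z" using n_ge_4 by (simp add: defect_diag)
  finally show ?thesis
    using dual.z_k_offdiag[OF assms] by (simp add: commutator_linear(5))
qed

text \<open>By the relation between \<open>k\<close> and \<open>q\<close>, the elements \<open>p a b\<close> are polynomials in elements that commute with \<open>z\<close>.\<close>
lemma z_p_offdiag:
  assumes "a < n" "b < n" "a \<noteq> b"
  shows "commutator z (p a b) = 0"
proof -
  obtain c where c: "c < n" "c \<noteq> a" "c \<noteq> b"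
    using two_more_indices[OF assms(1,2)] by blast
  have "commutator (commutator (k a c) (q c b)) z = 0"
    using assms c z_k_offdiag[of a c] z_q_offdiag[of c b]
      commutator_swap[of "k a c" z] commutator_swap[of "q c b" z]
    by (simp add: commutator_derivation commutator_linear)
  then have kqz: "commutator z (commutator (k a c) (q c b)) = 0"
    using commutator_swap[of z] by simp
  have qz: "commutator z (quad n x a b) = 0"
    using assms commutator_swap[of z "quad n x a b"] commutator_swap[of "x _ _" z]
    by (simp add: quad_def commutator_sum_left commutator_derivation anticommutator_linear z_x)
  have bz: "commutator z (nu * x a b) = 0"
    using assms commutator_swap[of z "nu * x a b"] commutator_swap[of "x a b" z]
    by (simp add: commutator_nu_left z_x)
  have "p a b = commutator (k a c) (q c b)
      + mu * (anticommutator (x a b) (x c c) + anticommutator (x a b) (x c c))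
      - nu * x a b - mu * quad n x a b"
    using r_offdiag[of a b c] assms c by (simp add: r_def algebra_simps)
  then show ?thesis
    using assms c kqz qz bz
    by (simp add: commutator_linear commutator_mu_right commutator_derivation anticommutator_linear z_x)
qed

lemma z_commutes:
  assumes "v \<in> {x, k, q, p}" "c < n" "d < n"
  shows "c \<noteq> d \<Longrightarrow> commutator z (v c d) = 0" "commutator z (v c c - v d d) = 0"
proof -
  have *: "commutator z (v c d) = 0" if "c < n" "d < n" "c \<noteq> d" for c d
    using assms(1) z_x z_k_offdiag z_q_offdiag z_p_offdiag that by auto
  then show "c \<noteq> d \<Longrightarrow> commutator z (v c d) = 0" using assms by blast
  have "gl_covariant n x v" using assms(1) x_covariant k_covariant q_covariant p_covariant by auto
  from offdiag_to_cartan[OF this * z_x] show "commutator z (v c c - v d d) = 0"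
    using assms by blast
qed

text \<open>The subtracted double sum is what the closed form of the relation contributes at the pair \<open>(H, H)\<close>, so that the
  value of the defect tensor and the terms with \<open>\<nu>\<close> are left.\<close>
lemma cartan_summand:
  assumes "a < n" "b < n" "a \<noteq> b"
  shows "commutator (k a a - k b b) (q a a - q b b)
    - mu * (\<Sum>(i, j)\<in>offdiag n. anticommutator (commutator (x a a - x b b) (x i j))
                                            (commutator (x j i) (x a a - x b b)))
    = z + z + nu * (x a a + x b b) + nu * (x a a + x b b)"
proof -
  let ?f = "\<lambda>i j. anticommutator (commutator (x a a - x b b) (x i j)) (commutator (x j i) (x a a - x b b))"
  have "commutator (x a a - x b b) (x i i) = 0" if "i < n" for i
    using assms that by (auto simp: commutator_linear brackets)
  then have "(\<Sum>(i, j)\<in>offdiag n. ?f i j) = (\<Sum>(i, j)\<in>{..<n} \<times> {..<n}. ?f i j)"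
    by (intro sum.mono_neutral_left) (auto simp: offdiag_def anticommutator_linear)
  also have "\<dots> = (\<Sum>i<n. \<Sum>j<n. ?f i j)"
    by (simp add: sum.cartesian_product)
  also have "\<dots> = quad n x a a + quad n x a a + quad n x b b + quad n x b b
     - (anticommutator (x a a) (x a a) + anticommutator (x a a) (x a a))
     - (anticommutator (x b b) (x b b) + anticommutator (x b b) (x b b))
     + (anticommutator (x a b) (x b a) + anticommutator (x a b) (x b a))
     + (anticommutator (x b a) (x a b) + anticommutator (x b a) (x a b))"
    using assms by (simp add: commutator_linear(3,4) anticommutator_linear(3,4) sum_subtractf
      sum_anticommutator_brackets[OF x_covariant])
  finally have sum: "(\<Sum>(i, j)\<in>offdiag n. ?f i j) = \<dots>" .
  show ?thesis
    unfolding sum defect_cartan[OF assms, symmetric] using assms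
    by (simp add: defect_def r_def s_def commutator_linear algebra_simps)
qed

definition Z where
  "Z = (\<Sum>a<n. let b = (a + 1) mod n in
      commutator (k a a - k b b) (q a a - q b b)
    - mu * (\<Sum>(i, j)\<in>offdiag n. anticommutator (commutator (x a a - x b b) (x i j))
                                            (commutator (x j i) (x a a - x b b))))"

text \<open>In the cyclic sum every diagonal \<open>x a a\<close> occurs equally often in the terms with \<open>\<nu>\<close>, and their total is zero.\<close>
lemma Z_eq: "Z = (\<Sum>a<n. z + z)"
proof -
  have "Z = (\<Sum>a<n. z + z + (nu * (x a a + x ((a + 1) mod n) ((a + 1) mod n))
        + nu * (x a a + x ((a + 1) mod n) ((a + 1) mod n))))"
    unfolding Z_def Let_def
  proof (rule sum.cong)
    fix a assume a: "a \<in> {..<n}"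
    have "a \<noteq> (a + 1) mod n"
      using a n_ge_4 by (cases "a + 1 = n") auto
    then show "commutator (k a a - k ((a + 1) mod n) ((a + 1) mod n)) (q a a - q ((a + 1) mod n) ((a + 1) mod n))
       - mu * (\<Sum>(i, j)\<in>offdiag n.
           anticommutator (commutator (x a a - x ((a + 1) mod n) ((a + 1) mod n)) (x i j))
             (commutator (x j i) (x a a - x ((a + 1) mod n) ((a + 1) mod n))))
      = z + z + (nu * (x a a + x ((a + 1) mod n) ((a + 1) mod n))
        + nu * (x a a + x ((a + 1) mod n) ((a + 1) mod n)))"
      using a n_ge_4 by (subst cartan_summand) (auto simp: add.assoc)
  qed simp
  also have "(\<Sum>a<n. x a a + x ((a + 1) mod n) ((a + 1) mod n)) = 0"
    using sum_cyclic_shift[of n "\<lambda>a. x a a"] n_ge_4 by (simp add: sum.distrib trace_x)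
  then have "(\<Sum>a<n. z + z + (nu * (x a a + x ((a + 1) mod n) ((a + 1) mod n))
        + nu * (x a a + x ((a + 1) mod n) ((a + 1) mod n)))) = (\<Sum>a<n. z + z)"
    unfolding sum.distrib[of "\<lambda>a. z + z"] sum.distrib[of "\<lambda>a. nu * _ a"] sum_distrib_left[symmetric] by simp
  finally show ?thesis .
qed

lemma Z_commutes:
  assumes "v \<in> {x, k, q, p}" "c < n" "d < n"
  shows "c \<noteq> d \<Longrightarrow> commutator Z (v c d) = 0" "commutator Z (v c c - v d d) = 0"
  using z_commutes[OF assms] by (simp_all add: Z_eq commutator_sum_left commutator_linear(1))

end

section \<open>The product of all quotients of a ring\<close>

definition two_sided_ideal :: "'r::ring set \<Rightarrow> bool"
  where "two_sided_ideal J \<longleftrightarrow>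
    0 \<in> J \<and> (\<forall>x\<in>J. \<forall>y\<in>J. x - y \<in> J) \<and> (\<forall>x\<in>J. \<forall>r. r * x \<in> J \<and> x * r \<in> J)"

lemma two_sided_idealD:
  assumes "two_sided_ideal J"
  shows "0 \<in> J" "x \<in> J \<Longrightarrow> y \<in> J \<Longrightarrow> x - y \<in> J" "x \<in> J \<Longrightarrow> - x \<in> J" "x \<in> J \<Longrightarrow> y \<in> J \<Longrightarrow> x + y \<in> J"
    "x \<in> J \<Longrightarrow> r * x \<in> J" "x \<in> J \<Longrightarrow> x * r \<in> J"
proof -
  show diff: "x - y \<in> J" if "x \<in> J" "y \<in> J" for x y
    using assms that by (simp add: two_sided_ideal_def)
  show "0 \<in> J" and "x \<in> J \<Longrightarrow> r * x \<in> J" and "x \<in> J \<Longrightarrow> x * r \<in> J"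
    using assms by (simp_all add: two_sided_ideal_def)
  show neg: "- x \<in> J" if "x \<in> J" for x
    using diff[OF \<open>0 \<in> J\<close> that] by simp
  show "x \<in> J \<Longrightarrow> y \<in> J \<Longrightarrow> x + y \<in> J"
    using diff[of x "- y"] neg[of y] by simp
qed

text \<open>A quotient by an ideal that is a free variable of a statement is not a type, but the product of the quotients by
  all two-sided ideals is one. Its elements are represented by families indexed by subsets of the ring; the values at
  subsets that are not ideals are left unconstrained and identified with each other.\<close>
definition congruent_mod_ideals :: "('r::ring set \<Rightarrow> 'r) \<Rightarrow> ('r set \<Rightarrow> 'r) \<Rightarrow> bool"
  where "congruent_mod_ideals f g \<longleftrightarrow> (\<forall>J. two_sided_ideal J \<longrightarrow> f J - g J \<in> J)"

lemma equivp_congruent_mod_ideals: "equivp (congruent_mod_ideals :: ('r::ring set \<Rightarrow> 'r) \<Rightarrow> _)"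
proof (rule equivpI)
  show "reflp (congruent_mod_ideals :: ('r set \<Rightarrow> 'r) \<Rightarrow> _)"
    by (rule reflpI) (simp add: congruent_mod_ideals_def two_sided_idealD)
  show "symp (congruent_mod_ideals :: ('r set \<Rightarrow> 'r) \<Rightarrow> _)"
    by (rule sympI) (metis congruent_mod_ideals_def minus_diff_eq two_sided_idealD(3))
  show "transp (congruent_mod_ideals :: ('r set \<Rightarrow> 'r) \<Rightarrow> _)"
  proof (rule transpI)
    fix f g h :: "'r set \<Rightarrow> 'r"
    assume fgh: "congruent_mod_ideals f g" "congruent_mod_ideals g h"
    have "(f J - g J) + (g J - h J) \<in> J" if "two_sided_ideal J" for J
      using fgh that by (intro two_sided_idealD(4)) (auto simp: congruent_mod_ideals_def)
    then show "congruent_mod_ideals f h" by (simp add: congruent_mod_ideals_def)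
  qed
qed

quotient_type (overloaded) 'r quotient_product = "'r::ring set \<Rightarrow> 'r" / congruent_mod_ideals
  by (rule equivp_congruent_mod_ideals)

instantiation quotient_product :: (ring) ring
begin

lift_definition zero_quotient_product :: "'a quotient_product" is "\<lambda>_. 0" .

lift_definition plus_quotient_product :: "'a quotient_product \<Rightarrow> 'a quotient_product \<Rightarrow> 'a quotient_product"
  is "\<lambda>f g J. f J + g J"
  by (simp add: congruent_mod_ideals_def add_diff_add two_sided_idealD)

lift_definition uminus_quotient_product :: "'a quotient_product \<Rightarrow> 'a quotient_product" is "\<lambda>f J. - f J"
proof -
  fix f f' :: "'a set \<Rightarrow> 'a"
  assume "congruent_mod_ideals f f'"
  then have "- (f J - f' J) \<in> J" if "two_sided_ideal J" for J
    by (intro two_sided_idealD(3)[OF that]) (simp add: congruent_mod_ideals_def that)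
  then show "congruent_mod_ideals (\<lambda>J. - f J) (\<lambda>J. - f' J)"
    by (simp add: congruent_mod_ideals_def)
qed

lift_definition minus_quotient_product :: "'a quotient_product \<Rightarrow> 'a quotient_product \<Rightarrow> 'a quotient_product"
  is "\<lambda>f g J. f J - g J"
proof -
  fix f f' g g' :: "'a set \<Rightarrow> 'a"
  assume "congruent_mod_ideals f f'" "congruent_mod_ideals g g'"
  then have "(f J - f' J) - (g J - g' J) \<in> J" if "two_sided_ideal J" for J
    by (intro two_sided_idealD(2)[OF that, of "f J - f' J"]) (simp_all add: congruent_mod_ideals_def that)
  then show "congruent_mod_ideals (\<lambda>J. f J - g J) (\<lambda>J. f' J - g' J)"
    by (simp add: congruent_mod_ideals_def algebra_simps)
qed

lift_definition times_quotient_product :: "'a quotient_product \<Rightarrow> 'a quotient_product \<Rightarrow> 'a quotient_product"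
  is "\<lambda>f g J. f J * g J"
proof -
  fix f f' g g' :: "'a set \<Rightarrow> 'a"
  assume "congruent_mod_ideals f f'" "congruent_mod_ideals g g'"
  then have "(f J - f' J) * g J + f' J * (g J - g' J) \<in> J" if "two_sided_ideal J" for J
    using that by (intro two_sided_idealD(4)[OF that] two_sided_idealD(5,6)) (auto simp: congruent_mod_ideals_def)
  then show "congruent_mod_ideals (\<lambda>J. f J * g J) (\<lambda>J. f' J * g' J)"
    by (simp add: congruent_mod_ideals_def algebra_simps)
qed

instance
  by standard (transfer, simp add: congruent_mod_ideals_def two_sided_idealD algebra_simps)+

end

text \<open>The embedding of the factor with index \<open>I\<close>. It respects sums and products but is not unital, for which reason
  scalars act through \<open>diagonal\<close>.\<close>
lift_definition at_factor :: "'r::ring set \<Rightarrow> 'r \<Rightarrow> 'r quotient_product"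
  is "\<lambda>I f J. if J = I then f else 0" .

lift_definition diagonal :: "'r::ring \<Rightarrow> 'r quotient_product" is "\<lambda>c J. c" .

lemma at_factor_eq_iff: "two_sided_ideal J \<Longrightarrow> at_factor J f = at_factor J g \<longleftrightarrow> f - g \<in> J"
  by (transfer fixing: J f g) (auto simp: congruent_mod_ideals_def two_sided_idealD)

lemma at_factor_hom:
  "at_factor J 0 = 0"
  "at_factor J (f + g) = at_factor J f + at_factor J g"
  "at_factor J (f - g) = at_factor J f - at_factor J g"
  "at_factor J (- f) = - at_factor J f"
  "at_factor J (f * g) = at_factor J f * at_factor J g"
  by (transfer; simp add: congruent_mod_ideals_def two_sided_idealD)+

lemma at_factor_sum: "at_factor J (\<Sum>i\<in>S. f i) = (\<Sum>i\<in>S. at_factor J (f i))"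
  by (induction S rule: infinite_finite_induct) (simp_all add: at_factor_hom)

lemma at_factor_brackets:
  "at_factor J (commutator f g) = commutator (at_factor J f) (at_factor J g)"
  "at_factor J (anticommutator f g) = anticommutator (at_factor J f) (at_factor J g)"
  by (simp_all add: commutator_def anticommutator_def at_factor_hom)

lemma diagonal_mult: "diagonal c * at_factor J f = at_factor J (c * f)"
  by (transfer) (auto simp: congruent_mod_ideals_def two_sided_idealD)

lemma diagonal_hom:
  "diagonal (c + d) = diagonal c + diagonal d"
  "diagonal (c - d) = diagonal c - diagonal d"
  "diagonal (c * d) = diagonal c * diagonal d"
  by (transfer; simp add: congruent_mod_ideals_def two_sided_idealD)+

lemma diagonal_central:
  assumes "\<And>f. c * f = f * c"
  shows "diagonal c * y = y * diagonal c"
  using assms by transfer (simp add: congruent_mod_ideals_def two_sided_idealD)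

section \<open>Ideals of free algebras\<close>

lemma ncpoly_as_sum: "f = (\<Sum>w\<in>Poly_Mapping.keys f. Poly_Mapping.single w (Poly_Mapping.lookup f w))"
  by (rule poly_mapping_eqI) (simp add: lookup_sum lookup_single when_def in_keys_iff)

lemma scal_hom: "scal 0 = 0" "scal 1 = 1" "scal (c + d) = scal c + scal d" "scal (c * d) = scal c * scal d"
  by (simp_all add: scal_def single_add mult_single)

lemma scal_diff: "scal (c - d) = scal c - scal d"
  by (simp add: scal_def single_diff)

lemma scal_central: "scal c * f = f * scal c"
proof -
  have "scal c * (\<Sum>w\<in>Poly_Mapping.keys f. Poly_Mapping.single w (Poly_Mapping.lookup f w))
      = (\<Sum>w\<in>Poly_Mapping.keys f. Poly_Mapping.single w (Poly_Mapping.lookup f w)) * scal c"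
    by (simp add: scal_def sum_distrib_left sum_distrib_right mult_single mult.commute)
  then show ?thesis by (simp flip: ncpoly_as_sum)
qed

lemma diagonal_scal:
  "diagonal (scal 1) * y = y" "diagonal (scal 0) * y = 0" "diagonal (scal (- 1)) * y = - y"
proof -
  show 1: "diagonal (scal 1) * y = y"
    by (transfer) (simp add: scal_hom congruent_mod_ideals_def two_sided_idealD)
  show 0: "diagonal (scal 0) * y = 0"
    by (transfer) (simp add: scal_hom congruent_mod_ideals_def two_sided_idealD)
  have "diagonal (scal (- 1)) * y + diagonal (scal 1) * y = diagonal (scal 0) * y"
    by (simp flip: distrib_right diagonal_hom scal_hom)
  then show "diagonal (scal (- 1)) * y = - y" by (simp add: 1 0 add_eq_0_iff2)
qed

lemma no_2_torsion_quotient_product: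
  fixes y :: "'g ncpoly quotient_product"
  assumes "y + y = 0"
  shows "y = 0"
proof -
  have half: "scal (1/2) * (f + f) = f" for f :: "'g ncpoly"
  proof -
    have "scal (1/2) * (f + f) = (scal (1/2) + scal (1/2)) * f"
      by (simp add: distrib_left distrib_right)
    then show ?thesis by (simp add: scal_hom(2) flip: scal_hom(3))
  qed
  have "diagonal (scal (1/2)) * (y + y) = y"
    by (transfer) (simp add: half congruent_mod_ideals_def two_sided_idealD)
  then show ?thesis using assms by simp
qed

text \<open>The retraction of the algebra of all noncommutative polynomials onto the free algebra on \<open>G\<close> that sends every
  other letter to zero. Pulling ideals back along it makes them ideals of the whole type without changing their
  elements inside the subalgebra.\<close>
lift_definition restrict_letters :: "'g set \<Rightarrow> 'g ncpoly \<Rightarrow> 'g ncpoly"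
  is "\<lambda>G f w. if set (letters w) \<subseteq> G then f w else 0"
  by (erule finite_subset[rotated]) auto

lemma restrict_letters_linear:
  "restrict_letters G 0 = 0"
  "restrict_letters G (f + g) = restrict_letters G f + restrict_letters G g"
  "restrict_letters G (f - g) = restrict_letters G f - restrict_letters G g"
  by (rule poly_mapping_eqI; simp add: restrict_letters.rep_eq lookup_add lookup_minus)+

lemma restrict_letters_sum: "restrict_letters G (\<Sum>i\<in>S. f i) = (\<Sum>i\<in>S. restrict_letters G (f i))"
  by (induction S rule: infinite_finite_induct) (simp_all add: restrict_letters_linear)

lemma restrict_letters_single:
  "restrict_letters G (Poly_Mapping.single w c) = (if set (letters w) \<subseteq> G then Poly_Mapping.single w c else 0)"
  by (rule poly_mapping_eqI) (simp add: restrict_letters.rep_eq lookup_single when_def)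

text \<open>Concatenated words lie over \<open>G\<close> precisely if both factors do.\<close>
lemma restrict_letters_mult: "restrict_letters G (f * g) = restrict_letters G f * restrict_letters G g"
proof -
  let ?S = "\<lambda>f. \<Sum>w\<in>Poly_Mapping.keys f. Poly_Mapping.single w (Poly_Mapping.lookup f w)"
  have "restrict_letters G (?S f * ?S g) = restrict_letters G (?S f) * restrict_letters G (?S g)"
    by (auto simp: sum_product restrict_letters_sum mult_single restrict_letters_single intro!: sum.cong)
  then show ?thesis by (simp flip: ncpoly_as_sum)
qed

lemma restrict_letters_carrier: "restrict_letters G f \<in> carrier (free_algebra G)"
  by (auto simp: free_algebra_def in_keys_iff restrict_letters.rep_eq split: if_splits)

lemma restrict_letters_id: "f \<in> carrier (free_algebra G) \<Longrightarrow> restrict_letters G f = f"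
  by (rule poly_mapping_eqI) (auto simp: free_algebra_def in_keys_iff restrict_letters.rep_eq)

lemma carrier_free_algebra:
  "gen g \<in> carrier (free_algebra G) \<longleftrightarrow> g \<in> G"
  "scal c \<in> carrier (free_algebra G)"
  "0 \<in> carrier (free_algebra G)"
  "x \<in> carrier (free_algebra G) \<Longrightarrow> y \<in> carrier (free_algebra G) \<Longrightarrow> x + y \<in> carrier (free_algebra G)"
  "x \<in> carrier (free_algebra G) \<Longrightarrow> y \<in> carrier (free_algebra G) \<Longrightarrow> x - y \<in> carrier (free_algebra G)"
  "x \<in> carrier (free_algebra G) \<Longrightarrow> y \<in> carrier (free_algebra G) \<Longrightarrow> x * y \<in> carrier (free_algebra G)"
  using keys_add[of x y] keys_diff[of x y] keys_mult[of x y]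
  by (fastforce simp: free_algebra_def gen_def scal_def)+

lemma carrier_free_algebra_sum:
  "(\<And>i. i \<in> S \<Longrightarrow> f i \<in> carrier (free_algebra G)) \<Longrightarrow> (\<Sum>i\<in>S. f i) \<in> carrier (free_algebra G)"
  by (induction S rule: infinite_finite_induct) (simp_all add: carrier_free_algebra)

lemma carrier_free_algebra_brackets:
  "x \<in> carrier (free_algebra G) \<Longrightarrow> y \<in> carrier (free_algebra G) \<Longrightarrow> commutator x y \<in> carrier (free_algebra G)"
  "x \<in> carrier (free_algebra G) \<Longrightarrow> y \<in> carrier (free_algebra G) \<Longrightarrow> anticommutator x y \<in> carrier (free_algebra G)"
  by (simp_all add: commutator_def anticommutator_def carrier_free_algebra)

lemma free_algebra_induct [consumes 1, case_names scal gen add mult]: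
  assumes "f \<in> carrier (free_algebra G)"
    and scal: "\<And>c. Q (scal c)" and gen: "\<And>g. g \<in> G \<Longrightarrow> Q (gen g)"
    and add: "\<And>f g. Q f \<Longrightarrow> Q g \<Longrightarrow> Q (f + g)" and mult: "\<And>f g. Q f \<Longrightarrow> Q g \<Longrightarrow> Q (f * g)"
  shows "Q f"
proof -
  have word: "Q (Poly_Mapping.single (FWord l) c)" if "set l \<subseteq> G" for l c
    using that
  proof (induction l)
    case Nil
    show ?case using scal[of c] by (simp add: scal_def zero_fword_def)
  next
    case (Cons g l)
    have "Poly_Mapping.single (FWord (g # l)) c = gen g * Poly_Mapping.single (FWord l) c"
      by (simp add: gen_def mult_single plus_fword_def)
    then show ?case using Cons gen mult by simp
  qed
  have "Q (\<Sum>w\<in>S. Poly_Mapping.single w (Poly_Mapping.lookup f w))"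
    if "finite S" "S \<subseteq> Poly_Mapping.keys f" for S
    using that
  proof (induction S)
    case empty
    show ?case using scal[of 0] by (simp add: scal_hom)
  next
    case (insert w S)
    then have "set (letters w) \<subseteq> G" using assms(1) by (simp add: free_algebra_def)
    then show ?case using insert add word[of "letters w"] by simp
  qed
  then show ?thesis using ncpoly_as_sum[of f] by (metis finite_keys order_refl)
qed

lemma ideal_free_algebra_closed:
  assumes "ideal I (free_algebra G)"
  shows "I \<subseteq> carrier (free_algebra G)" "0 \<in> I" "x \<in> I \<Longrightarrow> y \<in> I \<Longrightarrow> x + y \<in> I" "x \<in> I \<Longrightarrow> y \<in> I \<Longrightarrow> x - y \<in> I"
    "x \<in> I \<Longrightarrow> r \<in> carrier (free_algebra G) \<Longrightarrow> r * x \<in> I"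
    "x \<in> I \<Longrightarrow> r \<in> carrier (free_algebra G) \<Longrightarrow> x * r \<in> I"
proof -
  interpret ideal I "free_algebra G" by fact
  show sub: "I \<subseteq> carrier (free_algebra G)" by (rule a_subset)
  show "0 \<in> I" using additive_subgroup.zero_closed[OF is_additive_subgroup] by (simp add: free_algebra_def)
  show add: "x \<in> I \<Longrightarrow> y \<in> I \<Longrightarrow> x + y \<in> I" for x y using additive_subgroup.a_closed[OF is_additive_subgroup, of x y] by (simp add: free_algebra_def)
  show l: "x \<in> I \<Longrightarrow> r \<in> carrier (free_algebra G) \<Longrightarrow> r * x \<in> I" for x r
    using I_l_closed[of x r] by (simp add: free_algebra_def)
  show "x \<in> I \<Longrightarrow> r \<in> carrier (free_algebra G) \<Longrightarrow> x * r \<in> I"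
    using I_r_closed[of x r] by (simp add: free_algebra_def)
  have "scal (- 1) + (1 :: 'a ncpoly) = 0" by (simp add: scal_hom flip: scal_hom(2) scal_hom(3))
  then have "scal (- 1) = - (1 :: 'a ncpoly)" by (simp add: add_eq_0_iff2)
  then show "x \<in> I \<Longrightarrow> y \<in> I \<Longrightarrow> x - y \<in> I"
    using add[of x "- y"] l[of y "scal (- 1)"] carrier_free_algebra(2)[of "- 1" G] by simp
qed

lemma free_algebra_a_r_coset: "I +>\<^bsub>free_algebra G\<^esub> f = (\<lambda>h. h + f) ` I"
  by (auto simp: a_r_coset_def' free_algebra_def)

lemma coset_eq_iff:
  assumes "ideal I (free_algebra G)"
  shows "I +>\<^bsub>free_algebra G\<^esub> f = I +>\<^bsub>free_algebra G\<^esub> g \<longleftrightarrow> f - g \<in> I"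
proof
  assume eq: "I +>\<^bsub>free_algebra G\<^esub> f = I +>\<^bsub>free_algebra G\<^esub> g"
  have "f \<in> I +>\<^bsub>free_algebra G\<^esub> f"
    using ideal_free_algebra_closed(2)[OF assms] by (force simp: free_algebra_a_r_coset)
  then show "f - g \<in> I" unfolding eq by (auto simp: free_algebra_a_r_coset)
next
  assume fg: "f - g \<in> I"
  have "h + f \<in> (\<lambda>h. h + g) ` I" "h + g \<in> (\<lambda>h. h + f) ` I" if "h \<in> I" for h
    using ideal_free_algebra_closed(3,4)[OF assms that fg]
    by (auto intro: image_eqI[of _ _ "h + (f - g)"] image_eqI[of _ _ "h - (f - g)"])
  then show "I +>\<^bsub>free_algebra G\<^esub> f = I +>\<^bsub>free_algebra G\<^esub> g"
    unfolding free_algebra_a_r_coset by blast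
qed

definition pullback_ideal :: "'g set \<Rightarrow> 'g ncpoly set \<Rightarrow> 'g ncpoly set"
  where "pullback_ideal G I = {f. restrict_letters G f \<in> I}"

lemma two_sided_pullback_ideal:
  assumes "ideal I (free_algebra G)"
  shows "two_sided_ideal (pullback_ideal G I)"
  unfolding two_sided_ideal_def pullback_ideal_def
  using ideal_free_algebra_closed(2,4-6)[OF assms]
  by (auto simp: restrict_letters_linear restrict_letters_mult restrict_letters_carrier)

text \<open>The residue class of \<open>f\<close> modulo an ideal \<open>I\<close> of the free algebra on \<open>G\<close>, as an element of a type.\<close>
definition residue :: "'g set \<Rightarrow> 'g ncpoly set \<Rightarrow> 'g ncpoly \<Rightarrow> 'g ncpoly quotient_product"
  where "residue G I f = at_factor (pullback_ideal G I) f"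

lemma residue_eq_iff:
  assumes "ideal I (free_algebra G)" "f \<in> carrier (free_algebra G)" "g \<in> carrier (free_algebra G)"
  shows "residue G I f = residue G I g \<longleftrightarrow> f - g \<in> I"
  unfolding residue_def at_factor_eq_iff[OF two_sided_pullback_ideal[OF assms(1)]] using assms(2,3)
  by (simp add: pullback_ideal_def restrict_letters_id carrier_free_algebra)

lemma residue_scal: "residue G I (scal c * f) = diagonal (scal c) * residue G I f"
  by (simp add: residue_def diagonal_mult)

lemma residue_mult: "residue G I (f * g) = residue G I f * residue G I g"
  by (simp add: residue_def at_factor_hom)

lemmas residue_hom = at_factor_hom(1-4)[of "pullback_ideal _ _", folded residue_def]
  at_factor_brackets[of "pullback_ideal _ _", folded residue_def]
  at_factor_sum[of "pullback_ideal _ _", folded residue_def]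
  residue_scal

section \<open>Linear maps on traceless matrices\<close>

text \<open>The matrix unit \<open>E\<^sub>a\<^sub>b\<close> minus its trace part. Scalar matrices are central, so that these matrices satisfy the
  bracket relations of the matrix units while lying in \<open>sl\<^sub>n\<close> for all indices.\<close>
definition traceless_E :: "nat \<Rightarrow> nat \<Rightarrow> nat \<Rightarrow> complex mat"
  where "traceless_E n a b = mat n n (\<lambda>(i, j). (if i = a \<and> j = b then 1 else 0)
    - (if a = b \<and> i = j then 1 / of_nat n else 0))"

lemma sl_iff: "A \<in> sl n \<longleftrightarrow> dim_row A = n \<and> dim_col A = n \<and> (\<Sum>i<n. A $$ (i, i)) = 0"
  unfolding sl_def carrier_mat_def by simp

lemma sl_closed:
  "A \<in> sl n \<Longrightarrow> B \<in> sl n \<Longrightarrow> A + B \<in> sl n"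
  "A \<in> sl n \<Longrightarrow> c \<cdot>\<^sub>m A \<in> sl n"
  by (auto simp: sl_iff sum.distrib simp flip: sum_distrib_left)

lemma sl_lie:
  assumes "A \<in> sl n" "B \<in> sl n" shows "lie A B \<in> sl n"
proof -
  have "(\<Sum>i<n. \<Sum>j<n. A $$ (i, j) * B $$ (j, i)) = (\<Sum>i<n. \<Sum>j<n. B $$ (i, j) * A $$ (j, i))"
    by (subst sum.swap) (simp add: mult.commute)
  then show ?thesis
    using assms by (simp add: sl_iff lie_def scalar_prod_def sum_subtractf atLeast0LessThan)
qed

lemma zero_sl: "0\<^sub>m n n \<in> sl n"
  by (simp add: sl_iff)

lemma traceless_E_sl: "a < n \<Longrightarrow> b < n \<Longrightarrow> traceless_E n a b \<in> sl n"
  by (cases "a = b") (auto simp: traceless_E_def sl_iff sum_subtractf intro!: sum.neutral)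

lemma traceless_E_offdiag: "a \<noteq> b \<Longrightarrow> traceless_E n a b = E n a b"
  by (rule eq_matI) (auto simp: traceless_E_def E_def)

lemma H_traceless_E:
  "H n a = traceless_E n a a + (- 1) \<cdot>\<^sub>m traceless_E n ((a + 1) mod n) ((a + 1) mod n)"
  by (rule eq_matI) (auto simp: traceless_E_def E_def H_def)

lemma lie_traceless_E:
  assumes "a < n" "b < n" "c < n" "d < n"
  shows "lie (traceless_E n a b) (traceless_E n c d)
    = (if b = c then 1 else 0) \<cdot>\<^sub>m traceless_E n a d + (if a = d then - 1 else 0) \<cdot>\<^sub>m traceless_E n c b"
proof (rule eq_matI)
  fix i j assume "i < dim_row ((if b = c then 1 else 0) \<cdot>\<^sub>m traceless_E n a d + (if a = d then - 1 else 0) \<cdot>\<^sub>m traceless_E n c b)"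
     "j < dim_col ((if b = c then 1 else 0) \<cdot>\<^sub>m traceless_E n a d + (if a = d then - 1 else 0) \<cdot>\<^sub>m traceless_E n c b)"
  then have ij: "i < n" "j < n" by (simp_all add: traceless_E_def)
  have prod: "(traceless_E n a b * traceless_E n c d) $$ (i, j)
     = (if i = a \<and> b = c \<and> j = d then 1 else 0)
      - (if c = d \<and> i = a \<and> j = b then 1 / of_nat n else 0)
      - (if a = b \<and> i = c \<and> j = d then 1 / of_nat n else 0)
      + (if a = b \<and> c = d \<and> i = j then 1 / of_nat n * (1 / of_nat n) else 0)"
    if "a < n" "b < n" "c < n" "d < n" for a b c d
  proof -
    have "(\<Sum>k<n. ((if i = a \<and> k = b then 1 else 0) - (if a = b \<and> i = k then 1 / of_nat n else 0)) *
       ((if k = c \<and> j = d then 1 else 0) - (if c = d \<and> k = j then 1 / of_nat n else 0 :: complex)))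
      = (\<Sum>k<n. (if k = b then if i = a \<and> b = c \<and> j = d then 1 else 0 else 0)
        - (if k = b then if c = d \<and> i = a \<and> j = b then 1 / of_nat n else 0 else 0)
        - (if k = i then if a = b \<and> i = c \<and> j = d then 1 / of_nat n else 0 else 0)
        + (if k = i then if a = b \<and> c = d \<and> i = j then 1 / of_nat n * (1 / of_nat n) else 0 else 0))"
      (is "(\<Sum>k<n. (?P k - ?Q k) * (?R k - ?S k)) = (\<Sum>k<n. ?PR k - ?PS k - ?QR k + ?QS k)")
    proof (rule sum.cong)
      fix k
      have "?P k * ?R k = ?PR k" "?P k * ?S k = ?PS k" "?Q k * ?R k = ?QR k" "?Q k * ?S k = ?QS k"
        by simp_all
      then show "(?P k - ?Q k) * (?R k - ?S k) = ?PR k - ?PS k - ?QR k + ?QS k"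
        by (simp only: left_diff_distrib right_diff_distrib) simp
    qed simp
    also have "\<dots> = (if i = a \<and> b = c \<and> j = d then 1 else 0)
      - (if c = d \<and> i = a \<and> j = b then 1 / of_nat n else 0)
      - (if a = b \<and> i = c \<and> j = d then 1 / of_nat n else 0)
      + (if a = b \<and> c = d \<and> i = j then 1 / of_nat n * (1 / of_nat n) else 0)"
      using that ij by (simp only: sum.distrib sum_subtractf sum.delta finite_lessThan lessThan_iff if_True)
    finally show ?thesis
      using that ij by (simp add: traceless_E_def scalar_prod_def atLeast0LessThan)
  qed
  \<comment> \<open>The correction terms are symmetric under exchange of the two matrices.\<close>
  have cancel: "X - Q - R + S - (Y - R - Q + S) = X - Y" for X Y Q R S :: complex
    by simp
  have "lie (traceless_E n a b) (traceless_E n c d) $$ (i, j)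
      = (traceless_E n a b * traceless_E n c d) $$ (i, j) - (traceless_E n c d * traceless_E n a b) $$ (i, j)"
    using ij unfolding lie_def by (subst index_minus_mat(1)) (simp_all add: traceless_E_def)
  also have "\<dots> = (if i = a \<and> b = c \<and> j = d then 1 else 0) - (if i = c \<and> d = a \<and> j = b then 1 else 0)"
    unfolding prod[OF assms] prod[OF assms(3,4,1,2)] conj_left_commute[of "c = d" "a = b"] by (rule cancel)
  finally show "lie (traceless_E n a b) (traceless_E n c d) $$ (i, j) =
    ((if b = c then 1 else 0) \<cdot>\<^sub>m traceless_E n a d + (if a = d then - 1 else 0) \<cdot>\<^sub>m traceless_E n c b) $$ (i, j)"
    using ij assms by (cases "b = c"; cases "a = d") (simp_all add: traceless_E_def)
qed (simp_all add: lie_def traceless_E_def)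

lemma lie_tens:
  assumes "A \<in> carrier_mat n n" "B \<in> carrier_mat n n"
  shows "lie (A \<otimes>\<^sub>c f) (B \<otimes>\<^sub>c g) = lie A B \<otimes>\<^sub>c (f * g)"
proof -
  have "(A \<otimes>\<^sub>c f) * (B \<otimes>\<^sub>c g) = (A * B) \<otimes>\<^sub>c (f * g)"
    if "A \<in> carrier_mat n n" "B \<in> carrier_mat n n" for A B f g
    using that by (intro eq_matI)
      (auto simp: tens_def scalar_prod_def smult_sum ac_simps)
  then show ?thesis
    using assms unfolding lie_def
    by (intro eq_matI) (auto simp: tens_def smult_diff_left mult.commute simp del: index_mult_mat(1))
qed

lemma tens_linear:
  "A \<in> carrier_mat n n \<Longrightarrow> B \<in> carrier_mat n n \<Longrightarrow> (A + B) \<otimes>\<^sub>c f = A \<otimes>\<^sub>c f + B \<otimes>\<^sub>c f"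
  "(c \<cdot>\<^sub>m A) \<otimes>\<^sub>c f = [:c:] \<cdot>\<^sub>m (A \<otimes>\<^sub>c f)"
  by (intro eq_matI; auto simp: tens_def smult_add_left mult.commute)+

lemma tens_sl: "A \<in> sl n \<Longrightarrow> A \<otimes>\<^sub>c f \<in> sl n"
  by (simp add: sl_iff tens_def flip: smult_sum)

definition sl_linear :: "nat \<Rightarrow> (complex mat \<Rightarrow> 'g ncpoly quotient_product) \<Rightarrow> bool"
  where "sl_linear n V \<longleftrightarrow> (\<forall>A\<in>sl n. \<forall>B\<in>sl n. V (A + B) = V A + V B) \<and>
    (\<forall>c. \<forall>A\<in>sl n. V (c \<cdot>\<^sub>m A) = diagonal (scal c) * V A)"

lemma sl_linear_gl_covariant:
  assumes V: "sl_linear n V" and L: "\<And>A B. A \<in> sl n \<Longrightarrow> B \<in> sl n \<Longrightarrow> commutator (V A) (U B) = V (lie A B)"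
  shows "gl_covariant n (\<lambda>a b. U (traceless_E n a b)) (\<lambda>a b. V (traceless_E n a b))"
  unfolding gl_covariant_def using V
  by (auto simp: L traceless_E_sl lie_traceless_E sl_linear_def sl_closed diagonal_scal)

lemma sl_linear_zero:
  assumes "sl_linear n V"
  shows "V (0\<^sub>m n n) = 0"
proof -
  have "V (0 \<cdot>\<^sub>m 0\<^sub>m n n) = 0"
    using assms zero_sl[of n] unfolding sl_linear_def by (metis diagonal_scal(2))
  moreover have "0 \<cdot>\<^sub>m 0\<^sub>m n n = (0\<^sub>m n n :: complex mat)"
    by (rule eq_matI) auto
  ultimately show ?thesis by simp
qed

text \<open>The linear combination is written entrywise because matrices of variable size form no additive monoid, which
  rules out a sum over \<open>S\<close> of matrices.\<close>
lemma sl_linear_sum: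
  assumes V: "sl_linear n V" and "finite S" and M: "\<And>t. t \<in> S \<Longrightarrow> M t \<in> sl n"
  shows "mat n n (\<lambda>ij. \<Sum>t\<in>S. c t * M t $$ ij) \<in> sl n
    \<and> V (mat n n (\<lambda>ij. \<Sum>t\<in>S. c t * M t $$ ij)) = (\<Sum>t\<in>S. diagonal (scal (c t)) * V (M t))"
  using assms(2) M
proof (induction S)
  case empty
  have "mat n n (\<lambda>ij. \<Sum>t\<in>{}. c t * M t $$ ij) = 0\<^sub>m n n"
    by (intro eq_matI) auto
  then show ?case
    using zero_sl sl_linear_zero[OF V] by simp
next
  case (insert t S)
  have "mat n n (\<lambda>ij. \<Sum>t\<in>insert t S. c t * M t $$ ij)
      = c t \<cdot>\<^sub>m M t + mat n n (\<lambda>ij. \<Sum>t\<in>S. c t * M t $$ ij)"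
    using insert by (intro eq_matI) (auto simp: sl_iff)
  then show ?case
    using insert V by (simp add: sl_linear_def sl_closed)
qed

lemma sl_linear_trace:
  assumes "sl_linear n V" "n > 0"
  shows "(\<Sum>a<n. V (traceless_E n a a)) = 0"
proof -
  have "mat n n (\<lambda>ij. \<Sum>t<n. 1 * traceless_E n t t $$ ij) = 0\<^sub>m n n"
    using assms(2) by (intro eq_matI) (auto simp: traceless_E_def sum_subtractf intro!: sum.neutral)
  then show ?thesis
    using sl_linear_sum[OF assms(1), of "{..<n}" "\<lambda>t. traceless_E n t t" "\<lambda>_. 1"]
      sl_linear_zero[OF assms(1)]
    by (simp add: traceless_E_sl diagonal_scal)
qed

text \<open>The trace of \<open>A\<close> is zero, so that subtracting the multiple \<open>A\<^sub>a\<^sub>a\<close> of the \<open>(0, 0)\<close> unit from each diagonal term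
  changes nothing. This form uses the diagonal values of \<open>V\<close> only through their differences.\<close>
lemma sl_linear_expand:
  assumes "sl_linear n V" "A \<in> sl n"
  shows "V A = (\<Sum>(a, b)\<in>{..<n} \<times> {..<n}. diagonal (scal (A $$ (a, b))) *
     (V (traceless_E n a b) - (if a = b then V (traceless_E n 0 0) else 0)))"
proof -
  define M where "M = (\<lambda>(a, b). traceless_E n a b + (if a = b then - 1 else 0) \<cdot>\<^sub>m traceless_E n 0 0)"
  have M: "M t \<in> sl n" if "t \<in> {..<n} \<times> {..<n}" for t
    using that by (auto simp: M_def intro!: sl_closed traceless_E_sl)
  have "A = mat n n (\<lambda>ij. \<Sum>t\<in>{..<n} \<times> {..<n}. A $$ t * M t $$ ij)"
  proof (rule eq_matI)
    fix i j assume "i < dim_row (mat n n (\<lambda>ij. \<Sum>t\<in>{..<n} \<times> {..<n}. A $$ t * M t $$ ij))"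
      "j < dim_col (mat n n (\<lambda>ij. \<Sum>t\<in>{..<n} \<times> {..<n}. A $$ t * M t $$ ij))"
    then have ij: "i < n" "j < n" by auto
    have "(\<Sum>t\<in>{..<n} \<times> {..<n}. A $$ t * M t $$ (i, j)) =
      (\<Sum>a<n. \<Sum>b<n. A $$ (a, b) * M (a, b) $$ (i, j))"
      by (simp add: sum.cartesian_product)
    also have "\<dots> = (\<Sum>a<n. \<Sum>b<n. (if b = j then if a = i then A $$ (a, b) else 0 else 0)
        - (if b = a then if i = 0 \<and> j = 0 then A $$ (a, a) else 0 else 0))"
      using ij by (intro sum.cong) (auto simp: M_def traceless_E_def)
    also have "\<dots> = A $$ (i, j) - (\<Sum>a<n. if i = 0 \<and> j = 0 then A $$ (a, a) else 0)"
      using ij by (simp add: sum_subtractf)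
    also have "(\<Sum>a<n. if i = 0 \<and> j = 0 then A $$ (a, a) else 0) = 0"
      using assms(2) by (cases "i = 0 \<and> j = 0") (simp_all add: sl_iff del: de_Morgan_conj)
    finally show "A $$ (i, j) = mat n n (\<lambda>ij. \<Sum>t\<in>{..<n} \<times> {..<n}. A $$ t * M t $$ ij) $$ (i, j)"
      using ij by simp
  qed (use assms(2) in \<open>auto simp: sl_iff\<close>)
  then have "V A = (\<Sum>t\<in>{..<n} \<times> {..<n}. diagonal (scal (A $$ t)) * V (M t))"
    using sl_linear_sum[OF assms(1), of "{..<n} \<times> {..<n}" M "($$) A"] M by simp
  also have "\<dots> = (\<Sum>(a, b)\<in>{..<n} \<times> {..<n}. diagonal (scal (A $$ (a, b))) *
     (V (traceless_E n a b) - (if a = b then V (traceless_E n 0 0) else 0)))"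
    using assms(1) by (intro sum.cong) (auto simp: M_def sl_linear_def traceless_E_sl sl_closed diagonal_scal)
  finally show ?thesis .
qed

section \<open>Images of the current algebra\<close>

lemma env_relators_carrier: "env_relators n \<subseteq> carrier (free_algebra (sl n))"
proof -
  have "[:c:] \<cdot>\<^sub>m A \<in> sl n" if "A \<in> sl n" for c :: complex and A
    by (rule sl_closed) fact
  then show ?thesis
    by (auto simp: env_relators_def carrier_free_algebra carrier_free_algebra_brackets sl_closed sl_lie)
qed

lemma ideal_env_ideal: "ideal (env_ideal n) (free_algebra (sl n))"
  unfolding env_ideal_def by (rule ring.genideal_ideal[OF ring_free_algebra env_relators_carrier])

lemma env_relators_subset: "env_relators n \<subseteq> env_ideal n"
  unfolding env_ideal_def by (rule ring.genideal_self[OF ring_free_algebra env_relators_carrier])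

text \<open>Composing the generators of the free algebra over \<open>sl\<^sub>n[v]\<close> with the given homomorphism and with the passage from
  cosets to residues turns the relators of the enveloping algebra into equations: \<open>\<rho>\<close> is a representation of
  \<open>sl\<^sub>n[v]\<close> by elements of a ring.\<close>
lemma extends_to_envE:
  assumes "extends_to_env n J I" and I: "ideal I (dca_free n)"
    and G: "G = GX ` sl n \<union> GK ` sl n \<union> GQ ` sl n \<union> GP ` sl n"
    and J: "\<forall>A\<in>sl n. J A \<in> carrier (dca_free n)"
  obtains \<rho> where
    "\<And>A B. A \<in> sl n \<Longrightarrow> B \<in> sl n \<Longrightarrow> \<rho> (A + B) = \<rho> A + \<rho> B"
    "\<And>c A. A \<in> sl n \<Longrightarrow> \<rho> ([:c:] \<cdot>\<^sub>m A) = diagonal (scal c) * \<rho> A"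
    "\<And>A B. A \<in> sl n \<Longrightarrow> B \<in> sl n \<Longrightarrow> \<rho> (lie A B) = commutator (\<rho> A) (\<rho> B)"
    "\<And>A. A \<in> sl n \<Longrightarrow> \<rho> (A \<otimes>\<^sub>c 1) = residue G I (X' A)"
    "\<And>A. A \<in> sl n \<Longrightarrow> \<rho> (A \<otimes>\<^sub>c [:0, 1:]) = residue G I (J A)"
proof -
  have F: "dca_free n = free_algebra G"
    by (simp add: dca_free_def G)
  note I = I[unfolded F]
  interpret env: ideal "env_ideal n" "free_algebra (sl n)" by (rule ideal_env_ideal)
  interpret I: ideal I "free_algebra G" by (rule I)
  obtain \<phi> where \<phi>: "\<phi> \<in> Ring.ring_hom (env n) (free_algebra G Quot I)"
    and \<phi>_scal: "\<And>c. \<phi> (env_class n (scal c)) = I +>\<^bsub>free_algebra G\<^esub> scal c"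
    and \<phi>_1: "\<And>A. A \<in> sl n \<Longrightarrow> \<phi> (env_class n (gen (A \<otimes>\<^sub>c 1))) = I +>\<^bsub>free_algebra G\<^esub> X' A"
    and \<phi>_v: "\<And>A. A \<in> sl n \<Longrightarrow> \<phi> (env_class n (gen (A \<otimes>\<^sub>c [:0, 1:]))) = I +>\<^bsub>free_algebra G\<^esub> J A"
    using assms(1) unfolding extends_to_env_def F by blast
  define \<psi> where "\<psi> = \<phi> \<circ> env_class n"
  have "env_class n = (+>\<^bsub>free_algebra (sl n)\<^esub>) (env_ideal n)"
    by (simp add: env_class_def fun_eq_iff)
  then have \<psi>: "\<psi> \<in> Ring.ring_hom (free_algebra (sl n)) (free_algebra G Quot I)"
    unfolding \<psi>_def using env.rcos_ring_hom \<phi> by (auto simp: env_def intro: ring_hom_trans)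
  \<comment> \<open>The residue depends only on the coset, so that the choice of the representative does not matter.\<close>
  define \<kappa> where "\<kappa> C = residue G I (SOME f. f \<in> carrier (free_algebra G) \<and> C = I +>\<^bsub>free_algebra G\<^esub> f)" for C
  have \<kappa>: "\<kappa> (I +>\<^bsub>free_algebra G\<^esub> f) = residue G I f" if "f \<in> carrier (free_algebra G)" for f
  proof -
    define g where "g = (SOME g. g \<in> carrier (free_algebra G) \<and> I +>\<^bsub>free_algebra G\<^esub> f = I +>\<^bsub>free_algebra G\<^esub> g)"
    have "g \<in> carrier (free_algebra G) \<and> I +>\<^bsub>free_algebra G\<^esub> f = I +>\<^bsub>free_algebra G\<^esub> g"
      unfolding g_def by (rule someI[of _ f]) (use that in simp)
    then have "residue G I f = residue G I g"
      using coset_eq_iff[OF I] residue_eq_iff[OF I that] by blast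
    then show ?thesis by (simp add: \<kappa>_def g_def)
  qed
  have repr: "\<exists>h\<in>carrier (free_algebra G). \<psi> f = I +>\<^bsub>free_algebra G\<^esub> h" if "f \<in> carrier (free_algebra (sl n))" for f
    using ring_hom_closed[OF \<psi> that] by (auto simp: FactRing_def A_RCOSETS_def')
  define \<rho> where "\<rho> f = \<kappa> (\<psi> f)" for f
  have add: "\<rho> (f + g) = \<rho> f + \<rho> g"
    and mult: "\<rho> (f * g) = \<rho> f * \<rho> g" if fg: "f \<in> carrier (free_algebra (sl n))" "g \<in> carrier (free_algebra (sl n))" for f g
  proof -
    from repr fg obtain f' g' where 1: "f' \<in> carrier (free_algebra G)" "\<psi> f = I +>\<^bsub>free_algebra G\<^esub> f'"
      "g' \<in> carrier (free_algebra G)" "\<psi> g = I +>\<^bsub>free_algebra G\<^esub> g'" by metis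
    have "\<psi> (f + g) = I +>\<^bsub>free_algebra G\<^esub> (f' + g')"
      using ring_hom_add[OF \<psi> fg] 1 I.a_rcos_sum[of f' g'] by (simp add: FactRing_def) (simp add: free_algebra_def)
    moreover have "\<psi> (f * g) = I +>\<^bsub>free_algebra G\<^esub> (f' * g')"
      using ring_hom_mult[OF \<psi> fg] 1 I.rcoset_mult_add[of f' g'] by (simp add: FactRing_def) (simp add: free_algebra_def)
    ultimately show "\<rho> (f + g) = \<rho> f + \<rho> g" "\<rho> (f * g) = \<rho> f * \<rho> g"
      using 1 by (simp_all add: \<rho>_def \<kappa> carrier_free_algebra residue_hom residue_mult)
  qed
  have scal: "\<rho> (scal c) = residue G I (scal c)" for c
    by (simp add: \<rho>_def \<psi>_def \<phi>_scal \<kappa> carrier_free_algebra)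
  have zero: "\<rho> 0 = 0"
    using add[of 0 0] by (simp add: carrier_free_algebra)
  have diff: "\<rho> (f - g) = \<rho> f - \<rho> g" if "f \<in> carrier (free_algebra (sl n))" "g \<in> carrier (free_algebra (sl n))" for f g
    using add[of "f - g" g] that by (simp add: carrier_free_algebra)
  have relator: "\<rho> f = 0" if "f \<in> env_relators n" for f
  proof -
    have f: "f \<in> env_ideal n" using that env_relators_subset by blast
    then have "env_class n f = env_class n 0"
      using env.a_rcos_const[OF f] env.a_rcos_const[OF additive_subgroup.zero_closed[OF env.is_additive_subgroup]]
      by (simp add: env_class_def) (simp add: free_algebra_def)
    then show ?thesis using zero by (simp add: \<rho>_def \<psi>_def)
  qed
  have gens: "A \<in> sl n \<Longrightarrow> gen A \<in> carrier (free_algebra (sl n))" for A :: "complex poly mat"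
    by (simp add: carrier_free_algebra)
  note carrier = gens carrier_free_algebra(2-) carrier_free_algebra_brackets
  show thesis
  proof (rule that[of "\<lambda>A. \<rho> (gen A)"])
    fix A B :: "complex poly mat" and c assume A: "A \<in> sl n"
    have "gen ([:c:] \<cdot>\<^sub>m A) - scal c * gen A \<in> env_relators n"
      unfolding env_relators_def using A by (intro UnI1 UnI2) blast
    from relator[OF this] have "\<rho> (gen ([:c:] \<cdot>\<^sub>m A)) = residue G I (scal c) * \<rho> (gen A)"
      using A by (simp add: diff mult scal carrier sl_closed)
    moreover obtain h where "\<rho> (gen A) = residue G I h"
      unfolding \<rho>_def \<kappa>_def by blast
    ultimately show "\<rho> (gen ([:c:] \<cdot>\<^sub>m A)) = diagonal (scal c) * \<rho> (gen A)"
      by (simp add: residue_scal flip: residue_mult)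
    assume B: "B \<in> sl n"
    have "gen (A + B) - gen A - gen B \<in> env_relators n"
      unfolding env_relators_def using A B by (intro UnI1) blast
    from relator[OF this] have "\<rho> (gen (A + B)) - \<rho> (gen A) - \<rho> (gen B) = 0"
      using A B by (simp add: diff carrier sl_closed)
    then show "\<rho> (gen (A + B)) = \<rho> (gen A) + \<rho> (gen B)"
      by (simp add: algebra_simps)
    have "gen (lie A B) - commutator (gen A) (gen B) \<in> env_relators n"
      unfolding env_relators_def using A B by (intro UnI2) blast
    then have "0 = \<rho> (gen (lie A B) - (gen A * gen B - gen B * gen A))"
      by (simp only: relator flip: commutator_def)
    also have "\<dots> = \<rho> (gen (lie A B)) - \<rho> (gen A * gen B - gen B * gen A)"
      by (intro diff gens sl_lie A B carrier_free_algebra(5,6))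
    also have "\<rho> (gen A * gen B - gen B * gen A) = \<rho> (gen A * gen B) - \<rho> (gen B * gen A)"
      by (intro diff gens A B carrier_free_algebra(6))
    also have "\<dots> = \<rho> (gen A) * \<rho> (gen B) - \<rho> (gen B) * \<rho> (gen A)"
      by (simp only: mult gens A B)
    finally show "\<rho> (gen (lie A B)) = commutator (\<rho> (gen A)) (\<rho> (gen B))"
      by (simp add: commutator_def)
  next
    fix A :: "complex mat" assume A: "A \<in> sl n"
    show "\<rho> (gen (A \<otimes>\<^sub>c 1)) = residue G I (X' A)"
    proof -
      have "X' A \<in> carrier (free_algebra G)" using A by (simp add: carrier_free_algebra G)
      then show ?thesis using A by (simp add: \<rho>_def \<psi>_def \<phi>_1 \<kappa>)
    qed
    show "\<rho> (gen (A \<otimes>\<^sub>c [:0, 1:])) = residue G I (J A)"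
      using A J by (simp add: \<rho>_def \<psi>_def \<phi>_v \<kappa> F)
  qed
qed

section \<open>The defining relations in coordinates\<close>

lemma eps_inner:
  assumes "a < n" "b < n" "c < n" "d < n"
  shows "eps n a b \<bullet>c eps n c d = of_bool (a = c) - of_bool (a = d) - of_bool (b = c) + of_bool (b = d)"
proof -
  have "eps n a b \<bullet>c eps n c d = (\<Sum>i<n. ((if i = a then 1 else 0) - (if i = b then 1 else 0)) *
      ((if i = c then 1 else 0) - (if i = d then 1 else 0)))"
    unfolding scalar_prod_def by (rule sum.cong) (simp_all add: eps_def unit_vec_def atLeast0LessThan)
  also have "\<dots> = (\<Sum>i<n. (if i = a then of_bool (a = c) - of_bool (a = d) else 0)
      - (if i = b then of_bool (b = c) - of_bool (b = d) else 0))"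
    by (rule sum.cong) auto
  finally show ?thesis using assms by (simp add: sum_subtractf)
qed

lemma H_sl: "a < n \<Longrightarrow> H n a \<in> sl n"
  by (simp add: H_traceless_E sl_closed traceless_E_sl)

definition Z_poly :: "nat \<Rightarrow> complex \<Rightarrow> dca_gen ncpoly" where
  "Z_poly n lam = (\<Sum>a<n. (commutator (K' (H n a)) (Q' (H n a))
        - scal (lam / 4) *
            (\<Sum>(i, j)\<in>offdiag n.
               anticommutator (X' (lie (H n a) (E n i j))) (X' (lie (E n j i) (H n a))))))"

lemma Z_poly_carrier: "Z_poly n lam \<in> carrier (dca_free n)"
proof -
  have E: "E n i j \<in> sl n" if "(i, j) \<in> offdiag n" for i j
    using that traceless_E_sl[of i n j] by (simp add: offdiag_def traceless_E_offdiag)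
  have "E n j i \<in> sl n" if "(i, j) \<in> offdiag n" for i j
    using that E[of j i] by (simp add: offdiag_def)
  then show ?thesis
    unfolding Z_poly_def dca_free_def
    by (intro carrier_free_algebra_sum carrier_free_algebra carrier_free_algebra_brackets)
      (auto simp: carrier_free_algebra H_sl sl_lie E intro!: carrier_free_algebra_brackets)
qed

text \<open>The deformed double current algebra is the quotient by the least ideal with these properties; an arbitrary one is
  treated, since belonging to the least one means belonging to each.\<close>
locale dca_quotient =
  fixes n :: nat and lam \<beta> :: complex and I :: "dca_gen ncpoly set"
  assumes n_ge_4: "4 \<le> n"
    and ideal_I: "ideal I (dca_free n)"
    and P_rel: "P_relators n \<subseteq> I"
    and KQ_rel: "KQ_relators n lam \<beta> \<subseteq> I"
    and ext_K: "extends_to_env n K' I"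
    and ext_Q: "extends_to_env n Q' I"
begin

definition "gens = GX ` sl n \<union> GK ` sl n \<union> GQ ` sl n \<union> GP ` sl n"

lemma dca_free_eq: "dca_free n = free_algebra gens"
  by (simp add: dca_free_def gens_def)

abbreviation res :: "dca_gen ncpoly \<Rightarrow> dca_gen ncpoly quotient_product"
  where "res \<equiv> residue gens I"

lemma res_zero: "f \<in> I \<Longrightarrow> res f = 0"
  using residue_eq_iff[of I gens f 0] ideal_I ideal_free_algebra_closed(1)[of I gens]
  by (auto simp: dca_free_eq residue_hom carrier_free_algebra)

lemma gens_carrier:
  "\<forall>A\<in>sl n. K' A \<in> carrier (dca_free n)" "\<forall>A\<in>sl n. Q' A \<in> carrier (dca_free n)"
  by (simp_all add: dca_free_eq carrier_free_algebra gens_def)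

text \<open>The facts used about \<open>K\<close> and \<open>Q\<close> involve the current algebra only in degrees up to two: degree two enters through
  \<open>[A \<otimes> v, B \<otimes> v] = [A, B] \<otimes> v\<^sup>2\<close>, which vanishes for commuting \<open>A\<close>, \<open>B\<close>.\<close>
lemma current_algebra_image:
  assumes "extends_to_env n J I" and J: "\<forall>A\<in>sl n. J A \<in> carrier (dca_free n)"
  shows "sl_linear n (\<lambda>A. res (X' A))" "sl_linear n (\<lambda>A. res (J A))"
    and "\<And>A B. A \<in> sl n \<Longrightarrow> B \<in> sl n \<Longrightarrow> commutator (res (X' A)) (res (X' B)) = res (X' (lie A B))"
    and "\<And>A B. A \<in> sl n \<Longrightarrow> B \<in> sl n \<Longrightarrow> commutator (res (J A)) (res (X' B)) = res (J (lie A B))"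
    and "\<And>A B. A \<in> sl n \<Longrightarrow> B \<in> sl n \<Longrightarrow> lie A B = 0\<^sub>m n n \<Longrightarrow> commutator (res (J A)) (res (J B)) = 0"
proof -
  obtain \<rho> where add: "\<And>A B. A \<in> sl n \<Longrightarrow> B \<in> sl n \<Longrightarrow> \<rho> (A + B) = \<rho> A + \<rho> B"
    and smult: "\<And>c A. A \<in> sl n \<Longrightarrow> \<rho> ([:c:] \<cdot>\<^sub>m A) = diagonal (scal c) * \<rho> A"
    and lie: "\<And>A B. A \<in> sl n \<Longrightarrow> B \<in> sl n \<Longrightarrow> \<rho> (lie A B) = commutator (\<rho> A) (\<rho> B)"
    and \<rho>1: "\<And>A. A \<in> sl n \<Longrightarrow> \<rho> (A \<otimes>\<^sub>c 1) = res (X' A)"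
    and \<rho>v: "\<And>A. A \<in> sl n \<Longrightarrow> \<rho> (A \<otimes>\<^sub>c [:0, 1:]) = res (J A)"
    by (rule extends_to_envE[OF assms(1) ideal_I gens_def J]) (rule that)
  have carr: "A \<in> sl n \<Longrightarrow> A \<in> carrier_mat n n" for A :: "complex mat" by (simp add: sl_def)
  have lin: "sl_linear n (\<lambda>A. \<rho> (A \<otimes>\<^sub>c f))" for f
    by (auto simp: sl_linear_def tens_linear(1)[OF carr carr] tens_linear(2) add smult tens_sl)
  have cong: "sl_linear n U" if "sl_linear n V" "\<And>A. A \<in> sl n \<Longrightarrow> V A = U A" for U V
    using that by (simp add: sl_linear_def sl_closed)
  show "sl_linear n (\<lambda>A. res (X' A))" "sl_linear n (\<lambda>A. res (J A))"
    using cong[OF lin \<rho>1] cong[OF lin \<rho>v] by blast+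
  fix A B :: "complex mat" assume A: "A \<in> sl n" and B: "B \<in> sl n"
  have br: "commutator (\<rho> (A \<otimes>\<^sub>c f)) (\<rho> (B \<otimes>\<^sub>c g)) = \<rho> (lie A B \<otimes>\<^sub>c (f * g))" for f g
    using A B by (simp add: tens_sl lie[symmetric] lie_tens[OF carr carr])
  show "commutator (res (X' A)) (res (X' B)) = res (X' (lie A B))"
    using br[of 1 1] A B by (simp add: \<rho>1 sl_lie)
  show "commutator (res (J A)) (res (X' B)) = res (J (lie A B))"
    using br[of "[:0, 1:]" 1] A B by (simp add: \<rho>1 \<rho>v sl_lie)
  show "commutator (res (J A)) (res (J B)) = 0" if "lie A B = 0\<^sub>m n n"
    using br[of "[:0, 1:]" "[:0, 1:]"] A B sl_linear_zero[OF lin] by (simp add: \<rho>v that)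
qed

lemmas X_facts = current_algebra_image(1,3)[OF ext_K gens_carrier(1)]
lemmas K_facts = current_algebra_image(2,4,5)[OF ext_K gens_carrier(1)]
lemmas Q_facts = current_algebra_image(2,4,5)[OF ext_Q gens_carrier(2)]

lemma P_linear: "sl_linear n (\<lambda>A. res (P' A))"
  unfolding sl_linear_def
proof (intro conjI ballI allI)
  fix A B :: "complex mat" and c assume A: "A \<in> sl n"
  have "P' (c \<cdot>\<^sub>m A) - scal c * P' A \<in> P_relators n"
    unfolding P_relators_def using A by (intro UnI1 UnI2) blast
  from res_zero[OF subsetD[OF P_rel this]] show "res (P' (c \<cdot>\<^sub>m A)) = diagonal (scal c) * res (P' A)"
    by (simp add: residue_hom)
  assume B: "B \<in> sl n"
  have "P' (A + B) - P' A - P' B \<in> P_relators n"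
    unfolding P_relators_def using A B by (intro UnI1) blast
  from res_zero[OF subsetD[OF P_rel this]] show "res (P' (A + B)) = res (P' A) + res (P' B)"
    by (simp add: residue_hom algebra_simps)
qed

lemma P_bracket:
  assumes "A \<in> sl n" "B \<in> sl n"
  shows "commutator (res (P' A)) (res (X' B)) = res (P' (lie A B))"
proof -
  have "commutator (P' A) (X' B) - P' (lie A B) \<in> P_relators n"
    unfolding P_relators_def using assms by (intro UnI2) blast
  from res_zero[OF subsetD[OF P_rel this]] show ?thesis by (simp add: residue_hom)
qed

definition "xe a b = res (X' (traceless_E n a b))"
definition "ke a b = res (K' (traceless_E n a b))"
definition "qe a b = res (Q' (traceless_E n a b))"
definition "pe a b = res (P' (traceless_E n a b))"

lemma kq_algebra: "kq_algebra n xe ke qe pe (diagonal (scal (lam / 4))) (diagonal (scal (\<beta> - lam / 2)))"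
proof
  show "4 \<le> n" by (rule n_ge_4)
  show "diagonal (scal (lam / 4)) * y = y * diagonal (scal (lam / 4))"
    "diagonal (scal (\<beta> - lam / 2)) * y = y * diagonal (scal (\<beta> - lam / 2))"
    for y :: "dca_gen ncpoly quotient_product"
    by (rule diagonal_central, rule scal_central)+
  show "y = 0" if "y + y = 0" for y :: "dca_gen ncpoly quotient_product"
    using that by (rule no_2_torsion_quotient_product)
  show x: "gl_covariant n xe xe" and "gl_covariant n xe ke" "gl_covariant n xe qe" "gl_covariant n xe pe"
    unfolding xe_def[abs_def] ke_def[abs_def] qe_def[abs_def] pe_def[abs_def]
    by (rule sl_linear_gl_covariant; simp add: X_facts K_facts Q_facts P_linear P_bracket)+
  show "(\<Sum>a<n. xe a a) = 0"
    unfolding xe_def by (rule sl_linear_trace[OF X_facts(1)]) (use n_ge_4 in linarith)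
  have lie0: "lie (traceless_E n a b) (traceless_E n c d) = 0\<^sub>m n n"
    if "a < n" "b < n" "c < n" "d < n" "b \<noteq> c" "a \<noteq> d" for a b c d
    using that by (subst lie_traceless_E) (auto simp: traceless_E_def intro!: eq_matI)
  show "commutator (ke a b) (ke c d) = 0" "commutator (qe a b) (qe c d) = 0"
    if "a < n" "b < n" "c < n" "d < n" "b \<noteq> c" "a \<noteq> d" for a b c d
    unfolding ke_def qe_def using that by (simp_all add: K_facts Q_facts lie0 traceless_E_sl)
  fix a b c d assume i: "a < n" "b < n" "c < n" "d < n" and neq: "a \<noteq> b" "c \<noteq> d" "\<not> (a = d \<and> b = c)"
  let ?S = "anticommutator (xe a b) (xe c d)"
  have "commutator (K' (E n a b)) (Q' (E n c d)) - KQ_rhs n lam \<beta> a b c d \<in> KQ_relators n lam \<beta>"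
    unfolding KQ_relators_def offdiag_def using i neq by blast
  from res_zero[OF subsetD[OF KQ_rel this]] have "commutator (ke a b) (qe c d) = res (KQ_rhs n lam \<beta> a b c d)"
    using neq by (simp add: residue_hom ke_def qe_def traceless_E_offdiag)
  also have "\<dots> = res (P' (lie (traceless_E n a b) (traceless_E n c d)))
     + diagonal (scal (\<beta> - lam / 2)) * ((if b = c then xe a d else 0) + (if a = d then xe c b else 0))
     - diagonal (scal (lam / 4 * (eps n a b \<bullet>c eps n c d))) * ?S
     + diagonal (scal (lam / 4)) *
         (\<Sum>(i, j)\<in>offdiag n. anticommutator (commutator (xe a b) (xe i j)) (commutator (xe j i) (xe c d)))"
  proof -
    \<comment> \<open>If \<open>b = c\<close> then \<open>a \<noteq> d\<close>, so that \<open>E n a d\<close> is its own traceless part; otherwise the coefficient is zero.\<close>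
    have "diagonal (scal (of_bool (b = c))) * res (X' (E n a d)) = (if b = c then xe a d else 0)"
      "diagonal (scal (of_bool (a = d))) * res (X' (E n c b)) = (if a = d then xe c b else 0)"
      using neq by (auto simp: xe_def traceless_E_offdiag diagonal_scal)
    moreover have "(\<Sum>(i, j)\<in>offdiag n. anticommutator (res (X' (lie (E n a b) (E n i j)))) (res (X' (lie (E n j i) (E n c d)))))
       = (\<Sum>(i, j)\<in>offdiag n. anticommutator (commutator (xe a b) (xe i j)) (commutator (xe j i) (xe c d)))"
      using i neq by (intro sum.cong)
        (auto simp: offdiag_def xe_def X_facts traceless_E_sl simp flip: traceless_E_offdiag)
    ultimately show ?thesis
      using neq by (simp add: KQ_rhs_def residue_hom xe_def traceless_E_offdiag case_prod_unfold)
  qed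
  also have "res (P' (lie (traceless_E n a b) (traceless_E n c d))) = (if b = c then pe a d else 0) - (if a = d then pe c b else 0)"
    using gl_covariantD[OF \<open>gl_covariant n xe pe\<close> i] i by (simp only: pe_def xe_def P_bracket traceless_E_sl)
  also have "diagonal (scal (lam / 4 * (eps n a b \<bullet>c eps n c d))) * ?S = diagonal (scal (lam / 4)) *
      ((if a = c then ?S else 0) - (if a = d then ?S else 0) - (if b = c then ?S else 0) + (if b = d then ?S else 0))"
  proof -
    have "diagonal (scal (of_bool B)) * ?S = (if B then ?S else 0)" for B
      by (simp add: diagonal_scal)
    then have "diagonal (scal (eps n a b \<bullet>c eps n c d)) * ?S =
      (if a = c then ?S else 0) - (if a = d then ?S else 0) - (if b = c then ?S else 0) + (if b = d then ?S else 0)"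
      by (simp only: eps_inner[OF i] scal_hom scal_diff diagonal_hom distrib_right left_diff_distrib)
    then show ?thesis by (simp only: scal_hom diagonal_hom mult.assoc)
  qed
  finally show "commutator (ke a b) (qe c d) =
      (if b = c then pe a d + diagonal (scal (\<beta> - lam / 2)) * xe a d + diagonal (scal (lam / 4)) * quad n xe a d else 0)
    + (if a = d then - pe c b + diagonal (scal (\<beta> - lam / 2)) * xe c b + diagonal (scal (lam / 4)) * quad n xe c b else 0)
    - diagonal (scal (lam / 4)) * (anticommutator (xe a d) (xe c b) + anticommutator (xe a d) (xe c b))"
    unfolding sum_offdiag_brackets[OF x i]
    by (cases "b = c"; cases "a = d") (simp_all add: distrib_left right_diff_distrib)
qed

interpretation kq: kq_algebra n xe ke qe pe "diagonal (scal (lam / 4))" "diagonal (scal (\<beta> - lam / 2))"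
  by (rule kq_algebra)

lemma res_H:
  assumes "sl_linear n (\<lambda>A. res (V A))" "a < n"
  shows "res (V (H n a)) = res (V (traceless_E n a a)) - res (V (traceless_E n ((a + 1) mod n) ((a + 1) mod n)))"
  using assms by (simp add: H_traceless_E sl_linear_def traceless_E_sl sl_closed diagonal_scal)

lemma res_Z_poly: "res (Z_poly n lam) = kq.Z"
  unfolding Z_poly_def kq.Z_def Let_def residue_hom
proof (intro sum.cong refl arg_cong2[where f = minus] arg_cong[where f = "(*) _"])
  fix a assume a: "a \<in> {..<n}"
  let ?b = "(a + 1) mod n"
  show "commutator (res (K' (H n a))) (res (Q' (H n a))) = commutator (ke a a - ke ?b ?b) (qe a a - qe ?b ?b)"
    using a res_H[of K', OF K_facts(1), of a] res_H[of Q', OF Q_facts(1), of a]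
    by (simp add: ke_def qe_def)
  have H: "res (X' (H n a)) = xe a a - xe ?b ?b"
    using a res_H[of X', OF X_facts(1), of a] by (simp add: xe_def)
  have E: "E n i j \<in> sl n" "res (X' (E n i j)) = xe i j" if "i < n" "j < n" "i \<noteq> j" for i j
    using that traceless_E_sl[of i n j] by (simp_all add: xe_def traceless_E_offdiag)
  fix ij assume "ij \<in> offdiag n"
  then obtain i j where ij: "ij = (i, j)" "i < n" "j < n" "i \<noteq> j"
    by (auto simp: offdiag_def)
  have "res (X' (lie (H n a) (E n i j))) = commutator (xe a a - xe ?b ?b) (xe i j)"
    "res (X' (lie (E n j i) (H n a))) = commutator (xe j i) (xe a a - xe ?b ?b)"
    using a ij by (simp_all add: H_sl E H flip: X_facts(2))
  then show "res (case ij of (i, j) \<Rightarrow> anticommutator (X' (lie (H n a) (E n i j))) (X' (lie (E n j i) (H n a))))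
     = (case ij of (i, j) \<Rightarrow> anticommutator (commutator (xe a a - xe ?b ?b) (xe i j)) (commutator (xe j i) (xe a a - xe ?b ?b)))"
    by (simp add: ij residue_hom)
qed

lemma Z_commutes_linear:
  assumes V: "sl_linear n V" and v: "(\<lambda>a b. V (traceless_E n a b)) \<in> {xe, ke, qe, pe}" and A: "A \<in> sl n"
  shows "commutator kq.Z (V A) = 0"
proof -
  have smult: "commutator u (diagonal (scal c) * y) = diagonal (scal c) * commutator u y" for u y c
    using diagonal_central[of "scal c" u, OF scal_central]
    by (simp add: commutator_def right_diff_distrib flip: mult.assoc)
  have diag: "commutator kq.Z (V (traceless_E n a b) - (if a = b then V (traceless_E n 0 0) else 0)) = 0"
    if "a < n" "b < n" for a b
    using kq.Z_commutes[OF v, of a b] kq.Z_commutes[OF v, of a 0] that n_ge_4 by auto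
  show ?thesis
    unfolding sl_linear_expand[OF V A] commutator_sum_right
    by (rule sum.neutral) (auto simp: smult diag)
qed

text \<open>The elements whose residues commute with that of the given element form a subalgebra, so that the generators suffice.\<close>
lemma Z_poly_central_mod_ideal:
  assumes "f \<in> carrier (dca_free n)"
  shows "commutator (Z_poly n lam) f \<in> I"
proof -
  have "commutator (res (Z_poly n lam)) (res f) = 0"
    using assms unfolding dca_free_eq
  proof (induction rule: free_algebra_induct)
    case (scal c)
    have "commutator (Z_poly n lam) (scal c) = 0"
      using scal_central[of c "Z_poly n lam"] by (simp add: commutator_def)
    then show ?case by (metis residue_hom(1,5))
  next
    case (gen g)
    have "commutator kq.Z (res (X' A)) = 0" "commutator kq.Z (res (K' A)) = 0"
      "commutator kq.Z (res (Q' A)) = 0" "commutator kq.Z (res (P' A)) = 0" if "A \<in> sl n" for A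
      using that Z_commutes_linear[OF X_facts(1)] Z_commutes_linear[OF K_facts(1)]
        Z_commutes_linear[OF Q_facts(1)] Z_commutes_linear[OF P_linear]
      by (simp_all add: xe_def[abs_def] ke_def[abs_def] qe_def[abs_def] pe_def[abs_def])
    moreover from gen obtain A where "A \<in> sl n" "g = GX A \<or> g = GK A \<or> g = GQ A \<or> g = GP A"
      unfolding gens_def by auto
    ultimately show ?case by (auto simp: res_Z_poly)
  next
    case (add f g)
    then show ?case by (simp add: residue_hom commutator_linear)
  next
    case (mult f g)
    have "commutator z (f * g) = f * commutator z g + commutator z f * g" for z f g :: "dca_gen ncpoly quotient_product"
      by (simp add: commutator_def algebra_simps)
    with mult show ?case by (simp add: residue_mult)
  qed
  then have "res (commutator (Z_poly n lam) f) = res 0" by (simp add: residue_hom)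
  then show ?thesis
    using residue_eq_iff[of I gens "commutator (Z_poly n lam) f" 0] ideal_I Z_poly_carrier[of n lam] assms
    by (simp add: dca_free_eq carrier_free_algebra carrier_free_algebra_brackets)
qed

end

section \<open>Centrality\<close>

text \<open>The whole free algebra, with quotient zero, satisfies the defining conditions. Hence the intersection that defines
  the ideal of relations is not empty and is again an ideal.\<close>
lemma carrier_extends_to_env:
  assumes J: "\<forall>A\<in>sl n. J A \<in> carrier (dca_free n)"
  shows "extends_to_env n J (carrier (dca_free n))"
proof -
  let ?R = "dca_free n" and ?C = "carrier (dca_free n)"
  have ring: "ring ?R" unfolding dca_free_def by (rule ring_free_algebra)
  interpret ideal ?C ?R by (rule ring.oneideal[OF ring])
  have C: "?C +>\<^bsub>?R\<^esub> f = ?C" if "f \<in> ?C" for f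
    by (rule a_rcos_const[OF that])
  have zero: "\<zero>\<^bsub>?R\<^esub> \<in> ?C" by (rule ring.ring_simprules(2)[OF ring])
  have one: "\<one>\<^bsub>?R\<^esub> \<in> ?C" by (rule ring.ring_simprules(6)[OF ring])
  have hom: "(\<lambda>_. ?C) \<in> Ring.ring_hom (env n) (?R Quot ?C)"
  proof (rule ring_hom_memI)
    show "?C \<in> carrier (?R Quot ?C)"
      using C[OF zero] zero by (force simp: FactRing_def A_RCOSETS_def')
    show "?C = ?C \<otimes>\<^bsub>?R Quot ?C\<^esub> ?C"
      using rcoset_mult_add[OF zero zero] C[OF zero] C[OF ring.ring_simprules(5)[OF ring zero zero]]
      by (simp add: FactRing_def)
    show "?C = ?C \<oplus>\<^bsub>?R Quot ?C\<^esub> ?C"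
      using a_rcos_sum[OF zero zero] C[OF zero] C[OF ring.ring_simprules(1)[OF ring zero zero]]
      by (simp add: FactRing_def)
    show "?C = \<one>\<^bsub>?R Quot ?C\<^esub>"
      using C[OF one] by (simp add: FactRing_def)
  qed
  have "scal c \<in> ?C" "A \<in> sl n \<Longrightarrow> X' A \<in> ?C" for c A
    by (simp_all add: dca_free_def carrier_free_algebra)
  with hom J show ?thesis
    unfolding extends_to_env_def by (intro bexI[OF _ hom]) (simp add: C)
qed

lemma relators_carrier:
  "P_relators n \<subseteq> carrier (dca_free n)" "KQ_relators n lam \<beta> \<subseteq> carrier (dca_free n)"
proof -
  have gens: "X' A \<in> carrier (dca_free n)" "K' A \<in> carrier (dca_free n)"
    "Q' A \<in> carrier (dca_free n)" "P' A \<in> carrier (dca_free n)" if "A \<in> sl n" for A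
    using that by (simp_all add: dca_free_def carrier_free_algebra)
  let ?G = "GX ` sl n \<union> GK ` sl n \<union> GQ ` sl n \<union> GP ` sl n"
  note closed = carrier_free_algebra(2-)[where G = ?G, folded dca_free_def]
    carrier_free_algebra_brackets[where G = ?G, folded dca_free_def]
    carrier_free_algebra_sum[where G = ?G, folded dca_free_def]
  show "P_relators n \<subseteq> carrier (dca_free n)"
    by (auto simp: P_relators_def intro!: closed gens sl_closed sl_lie)
  have "commutator (K' (E n a b)) (Q' (E n c d)) - KQ_rhs n lam \<beta> a b c d \<in> carrier (dca_free n)"
    if *: "(a, b) \<in> offdiag n" "(c, d) \<in> offdiag n" "(a, b) \<noteq> (d, c)" for a b c d
  proof -
    have X: "scal (of_bool (b = c)) * X' (E n a d) \<in> carrier (dca_free n)"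
      "scal (of_bool (a = d)) * X' (E n c b) \<in> carrier (dca_free n)"
      using * traceless_E_sl[of a n d] traceless_E_sl[of c n b]
      by (cases "b = c"; cases "a = d"; simp add: scal_hom closed gens offdiag_def traceless_E_offdiag)+
    have E: "E n i j \<in> sl n" "E n j i \<in> sl n" if "(i, j) \<in> offdiag n" for i j
      using that traceless_E_sl[of i n j] traceless_E_sl[of j n i]
      by (simp_all add: offdiag_def traceless_E_offdiag)
    have PSKQ: "P' (lie (E n a b) (E n c d)) \<in> carrier (dca_free n)"
      "scal c' * anticommutator (X' (E n a b)) (X' (E n c d)) \<in> carrier (dca_free n)"
      "commutator (K' (E n a b)) (Q' (E n c d)) \<in> carrier (dca_free n)" for c'
      by (intro closed gens sl_lie E *(1,2))+
    have sum: "scal c' * (\<Sum>(i, j)\<in>offdiag n. anticommutator (X' (lie (E n a b) (E n i j)))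
        (X' (lie (E n j i) (E n c d)))) \<in> carrier (dca_free n)" for c'
      using E *(1,2) by (intro closed) (auto intro!: closed gens sl_lie simp: E(1)[OF *(1)] E(1)[OF *(2)])
    show ?thesis
      unfolding KQ_rhs_def
      by (rule closed(4)[OF PSKQ(3) closed(3)[OF closed(4)[OF closed(3)[OF PSKQ(1)
              closed(5)[OF closed(1) closed(3)[OF X]]] PSKQ(2)] sum]])
  qed
  then show "KQ_relators n lam \<beta> \<subseteq> carrier (dca_free n)"
    unfolding KQ_relators_def by blast
qed

lemma ideal_dca_ideal: "ideal (dca_ideal n lam \<beta>) (dca_free n)"
proof -
  have ring: "ring (dca_free n)" unfolding dca_free_def by (rule ring_free_algebra)
  have "\<forall>A\<in>sl n. K' A \<in> carrier (dca_free n)" "\<forall>A\<in>sl n. Q' A \<in> carrier (dca_free n)"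
    by (simp_all add: dca_free_def carrier_free_algebra)
  from this[THEN carrier_extends_to_env] show ?thesis
    unfolding dca_ideal_def using relators_carrier ring.oneideal[OF ring]
    by (intro ring.i_Intersect[OF ring]) blast+
qed

theorem theorem5p1:
  fixes n :: nat and lam \<beta> :: complex
  assumes "n \<ge> 4"
  shows "dca_class n lam \<beta>
      (\<Sum>a<n. (commutator (K' (H n a)) (Q' (H n a))
        - scal (lam / 4) *
            (\<Sum>(i, j)\<in>offdiag n.
               anticommutator (X' (lie (H n a) (E n i j))) (X' (lie (E n j i) (H n a))))))
    \<in> ring_center (dca n lam \<beta>)"
proof -
  let ?I = "dca_ideal n lam \<beta>" and ?Z = "Z_poly n lam"
  interpret ideal ?I "dca_free n" by (rule ideal_dca_ideal)
  have comm: "?I +>\<^bsub>dca_free n\<^esub> (?Z * f) = ?I +>\<^bsub>dca_free n\<^esub> (f * ?Z)" if f: "f \<in> carrier (dca_free n)" for f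
  proof -
    have "commutator ?Z f \<in> ?I"
      unfolding dca_ideal_def
    proof (rule InterI, clarify)
      fix I assume "ideal I (dca_free n)" "P_relators n \<subseteq> I" "KQ_relators n lam \<beta> \<subseteq> I"
        "extends_to_env n K' I" "extends_to_env n Q' I"
      then have "dca_quotient n lam \<beta> I" using assms by (intro dca_quotient.intro)
      then show "commutator ?Z f \<in> I" using f by (rule dca_quotient.Z_poly_central_mod_ideal)
    qed
    then show ?thesis
      using coset_eq_iff ideal_dca_ideal unfolding dca_free_def commutator_def by blast
  qed
  have "dca_class n lam \<beta> ?Z \<in> ring_center (dca n lam \<beta>)"
    unfolding ring_center_def
  proof (intro CollectI conjI ballI)
    show "dca_class n lam \<beta> ?Z \<in> carrier (dca n lam \<beta>)"
      using Z_poly_carrier by (auto simp: dca_def dca_class_def FactRing_def A_RCOSETS_def')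
    fix x assume "x \<in> carrier (dca n lam \<beta>)"
    then obtain f where f: "f \<in> carrier (dca_free n)" "x = dca_class n lam \<beta> f"
      by (auto simp: dca_def dca_class_def FactRing_def A_RCOSETS_def')
    have mult: "f \<otimes>\<^bsub>dca_free n\<^esub> g = f * g" for f g by (simp add: dca_free_def free_algebra_def)
    show "dca_class n lam \<beta> ?Z \<otimes>\<^bsub>dca n lam \<beta>\<^esub> x = x \<otimes>\<^bsub>dca n lam \<beta>\<^esub> dca_class n lam \<beta> ?Z"
      using rcoset_mult_add[OF Z_poly_carrier f(1)] rcoset_mult_add[OF f(1) Z_poly_carrier] comm[OF f(1)]
      by (simp add: dca_def dca_class_def FactRing_def f(2) mult)
  qed
  then show ?thesis by (simp only: Z_poly_def)
qed

end
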